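(* Let $(X,\kappa)$ be a Lefschetz complex, $\mathcal V$ a combinatorial multivector field on $X$ such that $X$ is invariant, and let $S\subseteq X$ be an isolated invariant set. Let $\mathbb P=\{1,2,\dots,n\}$ be ordered by the linear order of natural numbers and let $\{M_p: p\in\mathbb P\}$ be a Morse decomposition of $S$ (with this order admissible). Put $A_i:=M(\{1,\dots,i\})$ for $1\le i\le n$ and $A_0:=\emptyset$. Then for each $i\in\mathbb P$ the pair $(A_{i-1},M_i)$ is an attractor-repeller pair in $A_i$. Moreover, $$\sum_{i=1}^n p_{M_i}(t)=p_S(t)+(1+t)\sum_{i=1}^n q_i(t)$$ for some polynomials $q_i(t)$ with non-negative coefficients such that $q_i\neq 0$ implies $C(M_i,A_{i-1})\ne\emptyset$ for $i=2,3,\dots,n$.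
   Context: Fix a ring $R$ with unity; $\operatorname{rank}$ denotes the rank of a finitely generated $R$-module. A Lefschetz complex $(X,\kappa)$ is a finite set $X=\bigsqcup_{q\ge 0}X_q$ graded by non-negative integers with a map $\kappa:X\times X\to R$ such that $\kappa(x,y)\ne 0$ implies $x\in X_q$, $y\in X_{q-1}$ for some $q$, and $\sum_{y\in X}\kappa(x,y)\kappa(y,z)=0$ for all $x,z\in X$. Let $\le_\kappa$ be the smallest partial order on $X$ with $y\le_\kappa x$ whenever $\kappa(x,y)\neq 0$. $X$ carries the topology whose open sets are the upper sets of $\le_\kappa$, so $\operatorname{cl}A=\{y\in X: y\le_\kappa x\text{ for some }x\in A\}$; $\operatorname{cl}x=\operatorname{cl}\{x\}$, $\operatorname{mo}A:=\operatorname{cl}A\setminus A$. A set $A$ is proper if $\operatorname{mo}A$ is closed. The Lefschetz homology $H^\kappa(X)$ is the homology of the free chain complex $R(X)$ with basis $X$ and $\partial x=\sum_y\kappa(x,y)y$. A proper $A\subseteq X$ with $\kappa|_{A\times A}$ is again a Lefschetz complex, with homology $H^\kappa(A)$; put $p_A(t)=\sum_{i\ge 0}\operatorname{rank}H^\kappa_i(A)\,t^i$. A multivector is a proper $V\subseteq X$ with a unique maximal element $V^\star$ with respect to $\le_\kappa$; it is regular if $H^\kappa(V)=0$ and critical otherwise. A combinatorial multivector field $\mathcal V$ on $X$ is a partition of $X$ into multivectors; $[x]$ is the multivector containing $x$ and $x^\star:=[x]^\star$. Define $\Pi_{\mathcal V}:X\to\mathcal P(X)$ by: $y\in\Pi_{\mathcal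 V}(x)$ iff (a) $x\ne y=x^\star$, or (b) $x=x^\star$ and $y\in\operatorname{cl}x\setminus[x]$, or (c) $x=x^\star=y$ and $[x]$ is critical. For $N\subseteq X$ put $\Pi_{\mathcal V}(N)=\bigcup_{x\in N}\Pi_{\mathcal V}(x)$, $\Pi_{\mathcal V}^{-1}(N)=\{x:\Pi_{\mathcal V}(x)\cap N\ne\emptyset\}$. A solution is a map $\varphi$ from an interval of $\mathbb Z$ to $X$ with $\varphi(i+1)\in\Pi_{\mathcal V}(\varphi(i))$ whenever $i,i+1$ are in the interval; it is full if the interval is $\mathbb Z$, and it is a path (from its value at the left end to its value at the right end) if the interval is finite. $\operatorname{Sol}(x,A)$ is the set of full solutions with values in $A$ and with $x$ among their values; $\operatorname{Sol}(x)=\operatorname{Sol}(x,X)$. $A$ is $\mathcal V$-compatible if $x\in A$ implies $[x]\subseteq A$; $[A]_{\mathcal V}^-$ (resp. $[A]_{\mathcal V}^+$) is the largest $\mathcal V$-compatible subset (resp. smallest $\mathcal V$-compatible superset) of $A$. $\operatorname{Inv}A:=\{x\in A:\operatorname{Sol}(x^\star,[A]_{\mathcal V}^-)\ne\emptyset\}$; $A$ is invariant if $\operatorname{Inv}A=A$ (invariant sets are $\mathcal V$-compatible). An internal tangency of an invariant set $A$ is a path $\varphi$ from some $x\in A$ to some $y\in A$ with $\operatorname{im}\varphi\subseteq\operatorname{cl}A$ and $\operatorname{im}\varphi\cap\operatorname{mo}A\ne\emptyset$. An isolated invariant set is an invariant set that admits no internal tangencies. A trapping region (resp. backward trapping region)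 is a $\mathcal V$-compatible $N$ with $\Pi_{\mathcal V}(N)\subseteq N$ (resp. $\Pi_{\mathcal V}^{-1}(N)\subseteq N$). An attractor (resp. repeller) in $X$ is a set $\operatorname{Inv}N$ with $N$ a trapping (resp. backward trapping) region. $(A,Q)$ is an attractor-repeller pair in $X$ if $A$ is an attractor, $Q$ is a repeller, $Q=\operatorname{Inv}(X\setminus A)$ and $A=\operatorname{Inv}(X\setminus Q)$. For a full solution $\varphi$: $\alpha(\varphi)=\bigcap_{k\ge0}\operatorname{Inv}[\{\varphi(i):i\le -k\}]^+_{\mathcal V}$, $\omega(\varphi)=\bigcap_{k\ge0}\operatorname{Inv}[\{\varphi(i):i\ge k\}]^+_{\mathcal V}$. For $A,A'\subseteq X$, $C(A',A):=\{x\in X:\exists\varrho\in\operatorname{Sol}(x^\star),\ \alpha(\varrho)\subseteq A',\ \omega(\varrho)\subseteq A\}$. A family $\{M_r\}_{r\in\mathbb P}$ indexed by a finite set $\mathbb P$ is a Morse decomposition of $X$ if there is a partial order $\le$ on $\mathbb P$ (called admissible) such that: (i) the $M_r$ are mutually disjoint isolated invariant subsets of $X$; (ii) for every full solution $\varphi$ in $X$ there are $r\le r'$ in $\mathbb P$ with $\alpha(\varphi)\subseteq M_{r'}$, $\omega(\varphi)\subseteq M_r$; (iii) if $\alpha(\varphi)\cup\omega(\varphi)\subseteq M_r$ for a full solution $\varphi$ and $r\in\mathbb P$, then $\operatorname{im}\varphi\subseteq M_r$. For $I\subseteq\mathbb P$ the Morse set is $M(I):=\bigcup_{r,r'\in I}C(M_{r'},M_r)$.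 The source states that an invariant set is isolated invariant if and only if it is proper; on this basis an isolated invariant set $S$ is regarded as a Lefschetz complex $(S,\kappa|_{S\times S})$ with the combinatorial multivector field $\mathcal V|_S=\{V\in\mathcal V:V\subseteq S\}$. A Morse decomposition of $S$, the sets $M(I)$ and $C(\cdot,\cdot)$ in the claim are all taken with $(S,\mathcal V|_S)$ in place of $(X,\mathcal V)$; "attractor-repeller pair in $A_i$" is taken with $(A_i,\mathcal V|_{A_i})$ in place of $(X,\mathcal V)$.
   Formalization: The polynomial equation is proved for rings R over which rank is additive (for commutative R: no zero divisors), since it fails e.g. over Z/4; and S is explicitly assumed proper, since isolated invariant sets as defined need not be proper. *)

theory Defs
  imports
    "HOL-Library.Extended_Nat"
    "HOL-Library.Disjoint_Sets"
    "HOL-Computational_Algebra.Polynomial"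
begin

section \<open>Rank of modules\<close>

text \<open>
  The coefficient ring is a type of class \<^class>\<open>ring_1\<close>; it need not be commutative, and modules
  are left modules.  Every module below is a quotient \<open>M / N\<close> of submodules \<open>N \<subseteq> M\<close> of a
  module of functions \<open>'i \<Rightarrow> 'r\<close>, and it is represented by the pair \<open>M\<close>, \<open>N\<close>.
\<close>

definition left_submodule :: "('i \<Rightarrow> 'r::ring_1) set \<Rightarrow> bool" where
  "left_submodule N \<longleftrightarrow> (\<lambda>_. 0) \<in> N \<and> (\<forall>f\<in>N. \<forall>g\<in>N. (\<lambda>x. f x + g x) \<in> N)
     \<and> (\<forall>a. \<forall>f\<in>N. (\<lambda>x. a * f x) \<in> N)"

text \<open>The classes of \<open>u 0, \<dots>, u (n - 1)\<close> are linearly independent in the quotient by \<open>N\<close>.\<close>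

definition indep_mod :: "('i \<Rightarrow> 'r::ring_1) set \<Rightarrow> nat \<Rightarrow> (nat \<Rightarrow> 'i \<Rightarrow> 'r) \<Rightarrow> bool" where
  "indep_mod N n u \<longleftrightarrow>
     (\<forall>c :: nat \<Rightarrow> 'r. (\<lambda>x. \<Sum>i<n. c i * u i x) \<in> N \<longrightarrow> (\<forall>i<n. c i = 0))"

text \<open>The rank of \<open>M / N\<close>: the maximal number of linearly independent elements.\<close>

definition quot_rank :: "('i \<Rightarrow> 'r::ring_1) set \<Rightarrow> ('i \<Rightarrow> 'r) set \<Rightarrow> enat" where
  "quot_rank M N = (SUP n\<in>{n. \<exists>u. (\<forall>i<n. u i \<in> M) \<and> indep_mod N n u}. enat n)"

definition free_module :: "nat \<Rightarrow> (nat \<Rightarrow> 'r::ring_1) set" where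
  "free_module n = {f. \<forall>i\<ge>n. f i = 0}"

text \<open>
  The rings over which the rank is a rank function: the ring itself has rank \<open>1\<close>, and
  rank is additive on \<open>0 \<rightarrow> N/L \<rightarrow> M/L \<rightarrow> M/N \<rightarrow> 0\<close> for \<open>L \<subseteq> N \<subseteq> M \<subseteq> R\<^sup>n\<close>.
  Only the ring occurs in it.  A commutative ring has this property iff it has no zero divisors
  (\<open>rank_additive_commutative_iff\<close>); over the integers modulo \<open>4\<close> even the Morse equation for two
  Morse sets can fail.
\<close>

definition rank_additive :: "'r::ring_1 itself \<Rightarrow> bool" where
  "rank_additive _ \<longleftrightarrow>
     quot_rank (free_module 1 :: (nat \<Rightarrow> 'r) set) {\<lambda>_. 0} = 1 \<and>
     (\<forall>n. \<forall>L N M :: (nat \<Rightarrow> 'r) set.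
        left_submodule L \<longrightarrow> left_submodule N \<longrightarrow> left_submodule M \<longrightarrow>
        L \<subseteq> N \<longrightarrow> N \<subseteq> M \<longrightarrow> M \<subseteq> free_module n \<longrightarrow>
        quot_rank M L = quot_rank M N + quot_rank N L)"


section \<open>Lefschetz complexes\<close>

record ('x, 'r) lefschetz =
  cells :: "'x set"
  dm :: "'x \<Rightarrow> nat"
  kappa :: "'x \<Rightarrow> 'x \<Rightarrow> 'r"

definition lefschetz_complex :: "('x, 'r::ring_1) lefschetz \<Rightarrow> bool" where
  "lefschetz_complex K \<longleftrightarrow> finite (cells K)
     \<and> (\<forall>x\<in>cells K. \<forall>y\<in>cells K. kappa K x y \<noteq> 0 \<longrightarrow> dm K x = dm K y + 1)
     \<and> (\<forall>x\<in>cells K. \<forall>z\<in>cells K. (\<Sum>y\<in>cells K. kappa K x y * kappa K y z) = 0)"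

text \<open>
  All definitions evaluate \<^const>\<open>kappa\<close> only on pairs of cells, so shrinking the carrier amounts to
  restricting \<open>\<kappa>\<close> to \<open>A \<times> A\<close>.
\<close>

definition subcomplex :: "('x, 'r) lefschetz \<Rightarrow> 'x set \<Rightarrow> ('x, 'r) lefschetz" where
  "subcomplex K A = K\<lparr>cells := A\<rparr>"

text \<open>\<open>(y, x) \<in> face_order K\<close> stands for \<open>y \<le>\<^sub>\<kappa> x\<close>.\<close>

definition face_order :: "('x, 'r::ring_1) lefschetz \<Rightarrow> 'x rel" where
  "face_order K = \<Inter> {r. partial_order_on (cells K) r \<and>
     (\<forall>x\<in>cells K. \<forall>y\<in>cells K. kappa K x y \<noteq> 0 \<longrightarrow> (y, x) \<in> r)}"

definition cl :: "('x, 'r::ring_1) lefschetz \<Rightarrow> 'x set \<Rightarrow> 'x set" where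
  "cl K A = {y \<in> cells K. \<exists>x\<in>A. (y, x) \<in> face_order K}"

definition mo :: "('x, 'r::ring_1) lefschetz \<Rightarrow> 'x set \<Rightarrow> 'x set" where
  "mo K A = cl K A - A"

definition proper :: "('x, 'r::ring_1) lefschetz \<Rightarrow> 'x set \<Rightarrow> bool" where
  "proper K A \<longleftrightarrow> A \<subseteq> cells K \<and> cl K (mo K A) = mo K A"


section \<open>Lefschetz homology\<close>

text \<open>A chain \<open>c\<close> is the formal sum of the \<open>c x \<cdot> x\<close> over the cells \<open>x\<close>.\<close>

definition chains :: "('x, 'r::ring_1) lefschetz \<Rightarrow> nat \<Rightarrow> ('x \<Rightarrow> 'r) set" where
  "chains K q = {c. \<forall>x. c x \<noteq> 0 \<longrightarrow> x \<in> cells K \<and> dm K x = q}"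

definition bd :: "('x, 'r::ring_1) lefschetz \<Rightarrow> ('x \<Rightarrow> 'r) \<Rightarrow> 'x \<Rightarrow> 'r" where
  "bd K c = (\<lambda>y. if y \<in> cells K then \<Sum>x\<in>cells K. c x * kappa K x y else 0)"

definition cycles :: "('x, 'r::ring_1) lefschetz \<Rightarrow> nat \<Rightarrow> ('x \<Rightarrow> 'r) set" where
  "cycles K q = {c \<in> chains K q. bd K c = (\<lambda>_. 0)}"

definition boundaries :: "('x, 'r::ring_1) lefschetz \<Rightarrow> nat \<Rightarrow> ('x \<Rightarrow> 'r) set" where
  "boundaries K q = bd K ` chains K (q + 1)"

text \<open>The homology module in degree \<open>q\<close> is \<open>cycles K q / boundaries K q\<close>.\<close>

definition zero_homology :: "('x, 'r::ring_1) lefschetz \<Rightarrow> bool" where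
  "zero_homology K \<longleftrightarrow> (\<forall>q. cycles K q = boundaries K q)"

definition homology_rank :: "('x, 'r::ring_1) lefschetz \<Rightarrow> nat \<Rightarrow> enat" where
  "homology_rank K q = quot_rank (cycles K q) (boundaries K q)"

text \<open>Homology vanishes in every degree that is not the dimension of a cell.\<close>

definition poincare :: "('x, 'r::ring_1) lefschetz \<Rightarrow> int poly" where
  "poincare K = (\<Sum>q\<in>dm K ` cells K. monom (int (the_enat (homology_rank K q))) q)"


section \<open>Combinatorial multivector fields\<close>

definition is_maximal :: "('x, 'r::ring_1) lefschetz \<Rightarrow> 'x set \<Rightarrow> 'x \<Rightarrow> bool" where
  "is_maximal K V m \<longleftrightarrow> m \<in> V \<and> (\<forall>v\<in>V. (m, v) \<in> face_order K \<longrightarrow> v = m)"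

definition multivector :: "('x, 'r::ring_1) lefschetz \<Rightarrow> 'x set \<Rightarrow> bool" where
  "multivector K V \<longleftrightarrow> proper K V \<and> (\<exists>!m. is_maximal K V m)"

definition critical :: "('x, 'r::ring_1) lefschetz \<Rightarrow> 'x set \<Rightarrow> bool" where
  "critical K V \<longleftrightarrow> \<not> zero_homology (subcomplex K V)"

definition multivector_field :: "('x, 'r::ring_1) lefschetz \<Rightarrow> 'x set set \<Rightarrow> bool" where
  "multivector_field K \<V> \<longleftrightarrow> partition_on (cells K) \<V> \<and> (\<forall>V\<in>\<V>. multivector K V)"

definition restrict_field :: "'x set set \<Rightarrow> 'x set \<Rightarrow> 'x set set" where
  "restrict_field \<V> A = {V \<in> \<V>. V \<subseteq> A}"

text \<open>\<open>mv_of \<V> x\<close> is \<open>[x]\<close> and \<open>star K \<V> x\<close> is \<open>x\<^sup>\<star>\<close>.\<close>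

definition mv_of :: "'x set set \<Rightarrow> 'x \<Rightarrow> 'x set" where
  "mv_of \<V> x = (THE V. V \<in> \<V> \<and> x \<in> V)"

definition star :: "('x, 'r::ring_1) lefschetz \<Rightarrow> 'x set set \<Rightarrow> 'x \<Rightarrow> 'x" where
  "star K \<V> x = (THE m. is_maximal K (mv_of \<V> x) m)"

definition Pi_mv :: "('x, 'r::ring_1) lefschetz \<Rightarrow> 'x set set \<Rightarrow> 'x \<Rightarrow> 'x set" where
  "Pi_mv K \<V> x = {y \<in> cells K.
      (x \<noteq> y \<and> y = star K \<V> x)
    \<or> (x = star K \<V> x \<and> y \<in> cl K {x} - mv_of \<V> x)
    \<or> (x = star K \<V> x \<and> y = x \<and> critical K (mv_of \<V> x))}"

definition Pi_preimage :: "('x, 'r::ring_1) lefschetz \<Rightarrow> 'x set set \<Rightarrow> 'x set \<Rightarrow> 'x set" where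
  "Pi_preimage K \<V> N = {x \<in> cells K. Pi_mv K \<V> x \<inter> N \<noteq> {}}"


section \<open>Solutions and invariant sets\<close>

text \<open>Only the values of \<open>\<phi>\<close> on the interval \<open>J\<close> are relevant.\<close>

definition solution :: "('x, 'r::ring_1) lefschetz \<Rightarrow> 'x set set \<Rightarrow> int set \<Rightarrow> (int \<Rightarrow> 'x) \<Rightarrow> bool" where
  "solution K \<V> J \<phi> \<longleftrightarrow> \<phi> ` J \<subseteq> cells K \<and>
     (\<forall>i. i \<in> J \<and> i + 1 \<in> J \<longrightarrow> \<phi> (i + 1) \<in> Pi_mv K \<V> (\<phi> i))"

abbreviation full_solution :: "('x, 'r::ring_1) lefschetz \<Rightarrow> 'x set set \<Rightarrow> (int \<Rightarrow> 'x) \<Rightarrow> bool" where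
  "full_solution K \<V> \<phi> \<equiv> solution K \<V> UNIV \<phi>"

definition Sol :: "('x, 'r::ring_1) lefschetz \<Rightarrow> 'x set set \<Rightarrow> 'x \<Rightarrow> 'x set \<Rightarrow> (int \<Rightarrow> 'x) set" where
  "Sol K \<V> x A = {\<phi>. full_solution K \<V> \<phi> \<and> range \<phi> \<subseteq> A \<and> x \<in> range \<phi>}"

definition compatible :: "('x, 'r) lefschetz \<Rightarrow> 'x set set \<Rightarrow> 'x set \<Rightarrow> bool" where
  "compatible K \<V> A \<longleftrightarrow> A \<subseteq> cells K \<and> (\<forall>x\<in>A. mv_of \<V> x \<subseteq> A)"

definition lower_hull :: "('x, 'r) lefschetz \<Rightarrow> 'x set set \<Rightarrow> 'x set \<Rightarrow> 'x set" where
  "lower_hull K \<V> A = \<Union> {B. B \<subseteq> A \<and> compatible K \<V> B}"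

definition upper_hull :: "('x, 'r) lefschetz \<Rightarrow> 'x set set \<Rightarrow> 'x set \<Rightarrow> 'x set" where
  "upper_hull K \<V> A = \<Inter> {B. A \<subseteq> B \<and> compatible K \<V> B}"

definition Inv :: "('x, 'r::ring_1) lefschetz \<Rightarrow> 'x set set \<Rightarrow> 'x set \<Rightarrow> 'x set" where
  "Inv K \<V> A = {x \<in> A. Sol K \<V> (star K \<V> x) (lower_hull K \<V> A) \<noteq> {}}"

definition invariant :: "('x, 'r::ring_1) lefschetz \<Rightarrow> 'x set set \<Rightarrow> 'x set \<Rightarrow> bool" where
  "invariant K \<V> A \<longleftrightarrow> A \<subseteq> cells K \<and> Inv K \<V> A = A"

definition internal_tangency ::
  "('x, 'r::ring_1) lefschetz \<Rightarrow> 'x set set \<Rightarrow> 'x set \<Rightarrow> int \<Rightarrow> int \<Rightarrow> (int \<Rightarrow> 'x) \<Rightarrow> bool" where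
  "internal_tangency K \<V> A a b \<phi> \<longleftrightarrow> a \<le> b \<and> solution K \<V> {a..b} \<phi> \<and> \<phi> a \<in> A \<and> \<phi> b \<in> A \<and>
     \<phi> ` {a..b} \<subseteq> cl K A \<and> \<phi> ` {a..b} \<inter> mo K A \<noteq> {}"

text \<open>
  These conditions alone do not make an isolated invariant set \<^const>\<open>proper\<close>: a path may return to
  it through a dominant cell \<open>x\<^sup>\<star>\<close> outside its closure.  Where such a set is used as a Lefschetz
  complex, properness has to be assumed separately.
\<close>

definition isolated_invariant :: "('x, 'r::ring_1) lefschetz \<Rightarrow> 'x set set \<Rightarrow> 'x set \<Rightarrow> bool" where
  "isolated_invariant K \<V> A \<longleftrightarrow>
     invariant K \<V> A \<and> \<not> (\<exists>a b \<phi>. internal_tangency K \<V> A a b \<phi>)"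


section \<open>Attractors, repellers and Morse decompositions\<close>

definition trapping_region :: "('x, 'r::ring_1) lefschetz \<Rightarrow> 'x set set \<Rightarrow> 'x set \<Rightarrow> bool" where
  "trapping_region K \<V> N \<longleftrightarrow> compatible K \<V> N \<and> (\<Union>x\<in>N. Pi_mv K \<V> x) \<subseteq> N"

definition backward_trapping_region ::
  "('x, 'r::ring_1) lefschetz \<Rightarrow> 'x set set \<Rightarrow> 'x set \<Rightarrow> bool" where
  "backward_trapping_region K \<V> N \<longleftrightarrow> compatible K \<V> N \<and> Pi_preimage K \<V> N \<subseteq> N"

definition attractor :: "('x, 'r::ring_1) lefschetz \<Rightarrow> 'x set set \<Rightarrow> 'x set \<Rightarrow> bool" where
  "attractor K \<V> A \<longleftrightarrow> (\<exists>N. trapping_region K \<V> N \<and> A = Inv K \<V> N)"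

definition repeller :: "('x, 'r::ring_1) lefschetz \<Rightarrow> 'x set set \<Rightarrow> 'x set \<Rightarrow> bool" where
  "repeller K \<V> Q \<longleftrightarrow> (\<exists>N. backward_trapping_region K \<V> N \<and> Q = Inv K \<V> N)"

definition attractor_repeller_pair ::
  "('x, 'r::ring_1) lefschetz \<Rightarrow> 'x set set \<Rightarrow> 'x set \<Rightarrow> 'x set \<Rightarrow> bool" where
  "attractor_repeller_pair K \<V> A Q \<longleftrightarrow> attractor K \<V> A \<and> repeller K \<V> Q \<and>
     Q = Inv K \<V> (cells K - A) \<and> A = Inv K \<V> (cells K - Q)"

definition alpha_limit :: "('x, 'r::ring_1) lefschetz \<Rightarrow> 'x set set \<Rightarrow> (int \<Rightarrow> 'x) \<Rightarrow> 'x set" where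
  "alpha_limit K \<V> \<phi> = (\<Inter>k::nat. Inv K \<V> (upper_hull K \<V> (\<phi> ` {..- int k})))"

definition omega_limit :: "('x, 'r::ring_1) lefschetz \<Rightarrow> 'x set set \<Rightarrow> (int \<Rightarrow> 'x) \<Rightarrow> 'x set" where
  "omega_limit K \<V> \<phi> = (\<Inter>k::nat. Inv K \<V> (upper_hull K \<V> (\<phi> ` {int k..})))"

definition connections ::
  "('x, 'r::ring_1) lefschetz \<Rightarrow> 'x set set \<Rightarrow> 'x set \<Rightarrow> 'x set \<Rightarrow> 'x set" where
  "connections K \<V> A' A = {x \<in> cells K. \<exists>\<rho>\<in>Sol K \<V> (star K \<V> x) (cells K).
     alpha_limit K \<V> \<rho> \<subseteq> A' \<and> omega_limit K \<V> \<rho> \<subseteq> A}"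

text \<open>\<open>{M\<^sub>r}\<close>, \<open>r \<in> P\<close>, is a Morse decomposition for which the partial order \<open>ord\<close> is admissible.\<close>

definition morse_decomposition :: "('x, 'r::ring_1) lefschetz \<Rightarrow> 'x set set \<Rightarrow>
    'p set \<Rightarrow> 'p rel \<Rightarrow> ('p \<Rightarrow> 'x set) \<Rightarrow> bool" where
  "morse_decomposition K \<V> P ord M \<longleftrightarrow> finite P \<and> partial_order_on P ord
     \<and> (\<forall>r\<in>P. isolated_invariant K \<V> (M r))
     \<and> (\<forall>r\<in>P. \<forall>s\<in>P. r \<noteq> s \<longrightarrow> M r \<inter> M s = {})
     \<and> (\<forall>\<phi>. full_solution K \<V> \<phi> \<longrightarrow>
          (\<exists>(r, r')\<in>ord. alpha_limit K \<V> \<phi> \<subseteq> M r' \<and> omega_limit K \<V> \<phi> \<subseteq> M r))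
     \<and> (\<forall>\<phi>. \<forall>r\<in>P. full_solution K \<V> \<phi> \<and> alpha_limit K \<V> \<phi> \<union> omega_limit K \<V> \<phi> \<subseteq> M r
          \<longrightarrow> range \<phi> \<subseteq> M r)"

definition morse_set :: "('x, 'r::ring_1) lefschetz \<Rightarrow> 'x set set \<Rightarrow>
    ('p \<Rightarrow> 'x set) \<Rightarrow> 'p set \<Rightarrow> 'x set" where
  "morse_set K \<V> M I = (\<Union>r\<in>I. \<Union>r'\<in>I. connections K \<V> (M r') (M r))"


section \<open>Commutative rings with additive rank are the integral domains\<close>

lemma quot_rank_ge:
  assumes "\<forall>i<n. u i \<in> M" "indep_mod N n u"
  shows "enat n \<le> quot_rank M N"
  unfolding quot_rank_def using assms by (intro SUP_upper) auto

lemma quot_rank_enatE: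
  assumes "quot_rank M N = enat p"
  obtains u where "\<forall>i<p. u i \<in> M" "indep_mod N p u"
proof -
  let ?A = "{n. \<exists>u. (\<forall>i<n. u i \<in> M) \<and> indep_mod N n u}"
  have bound: "n \<le> p" if "n \<in> ?A" for n
    using that quot_rank_ge[of n _ M N] assms by auto
  have fin: "finite ?A" by (rule finite_subset[of _ "{..p}"]) (use bound in auto)
  have ne: "0 \<in> ?A" by (simp add: indep_mod_def)
  have "Max (enat ` ?A) = Sup (enat ` ?A)"
    using fin ne by (intro Max_Sup) auto
  moreover have "Max (enat ` ?A) \<in> enat ` ?A"
    using fin ne by (intro Max_in) auto
  ultimately have "enat p \<in> enat ` ?A"
    using assms by (simp only: quot_rank_def)
  then have "p \<in> ?A" by blast
  then show ?thesis using that by blast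
qed

lemma left_submodule_add: "left_submodule N \<Longrightarrow> f \<in> N \<Longrightarrow> g \<in> N \<Longrightarrow> (\<lambda>x. f x + g x) \<in> N"
  and left_submodule_scale: "left_submodule N \<Longrightarrow> f \<in> N \<Longrightarrow> (\<lambda>x. a * f x) \<in> N"
  by (simp_all add: left_submodule_def)

lemma left_submodule_sum:
  assumes "left_submodule N" "finite J" "\<And>j. j \<in> J \<Longrightarrow> f j \<in> N"
  shows "(\<lambda>x. \<Sum>j\<in>J. c j * f j x) \<in> N"
  using assms(2,3)
proof (induction J rule: finite_induct)
  case empty
  then show ?case using assms(1) by (simp add: left_submodule_def)
next
  case (insert j J)
  have a: "(\<lambda>x. c j * f j x) \<in> N"
    using assms(1) insert.prems by (simp add: left_submodule_def)
  have b: "(\<lambda>x. \<Sum>j\<in>J. c j * f j x) \<in> N"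
    using insert by auto
  have "(\<lambda>x. c j * f j x + (\<Sum>j\<in>J. c j * f j x)) \<in> N"
    by (rule left_submodule_add[OF assms(1) a b])
  then show ?case using insert.hyps by simp
qed

lemma quot_rank_superadditive:
  fixes L N M :: "('i \<Rightarrow> 'r::ring_1) set"
  assumes N: "left_submodule N" and "L \<subseteq> N" "N \<subseteq> M"
  shows "quot_rank M N + quot_rank N L \<le> quot_rank M L"
proof -
  have step: "enat (p + q) \<le> quot_rank M L"
    if u: "\<forall>i<p. u i \<in> M" "indep_mod N p u" and v: "\<forall>i<q. v i \<in> N" "indep_mod L q v"
    for p q :: nat and u v :: "nat \<Rightarrow> 'i \<Rightarrow> 'r"
  proof (rule quot_rank_ge)
    let ?w = "\<lambda>i. if i < p then u i else v (i - p)"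
    show "\<forall>i<p + q. ?w i \<in> M" using u v assms by auto
    show "indep_mod L (p + q) ?w"
      unfolding indep_mod_def
    proof (intro allI impI)
      fix c :: "nat \<Rightarrow> 'r" and i
      assume c: "(\<lambda>x. \<Sum>i<p + q. c i * ?w i x) \<in> L" and i: "i < p + q"
      let ?f = "\<lambda>x. \<Sum>i<p. c i * u i x" and ?g = "\<lambda>x. \<Sum>i<q. c (p + i) * v i x"
      have "(\<Sum>i<p + q. c i * ?w i x) = ?f x + ?g x" for x
      proof -
        have "(\<Sum>i<p + q. c i * ?w i x) = (\<Sum>i<p. c i * ?w i x) + (\<Sum>i=p..<p + q. c i * ?w i x)"
          unfolding lessThan_atLeast0 by (rule sum.atLeastLessThan_concat[symmetric]) auto
        also have "(\<Sum>i=p..<p + q. c i * ?w i x) = ?g x"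
          using sum.shift_bounds_nat_ivl[of "\<lambda>i. c i * ?w i x" 0 p q]
          by (simp add: lessThan_atLeast0 add.commute)
        finally show ?thesis by simp
      qed
      then have fg: "(\<lambda>x. ?f x + ?g x) \<in> L" using c by simp
      have g: "?g \<in> N" by (rule left_submodule_sum[OF N]) (use v in auto)
      have "(\<lambda>x. (-1) * ?g x) \<in> N" by (rule left_submodule_scale[OF N g])
      then have "(\<lambda>x. (?f x + ?g x) + (-1) * ?g x) \<in> N"
        using left_submodule_add[OF N] fg \<open>L \<subseteq> N\<close> by blast
      then have "?f \<in> N" by simp
      then have c0: "\<forall>i<p. c i = 0" using u by (simp add: indep_mod_def)
      then have "?g \<in> L" using fg by simp
      then have "\<forall>i<q. c (p + i) = 0"
        using v(2)[unfolded indep_mod_def, rule_format, of "\<lambda>i. c (p + i)"] by blast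
      then show "c i = 0" using c0 i
        by (metis add_less_cancel_left le_add_diff_inverse not_less)
    qed
  qed
  show ?thesis
  proof (cases "quot_rank M L")
    case (enat m)
    have *: "quot_rank M N + enat q \<le> enat m"
      if v: "\<forall>i<q. v i \<in> N" "indep_mod L q v" for q v
    proof -
      have "quot_rank M N \<le> enat (m - q)"
        unfolding quot_rank_def
      proof (rule SUP_least)
        fix p assume "p \<in> {n. \<exists>u. (\<forall>i<n. u i \<in> M) \<and> indep_mod N n u}"
        then have "p + q \<le> m" using step v enat by fastforce
        then show "enat p \<le> enat (m - q)" by simp
      qed
      moreover have "q \<le> m" using step[of 0 undefined q v] v enat by (simp add: indep_mod_def)
      ultimately show ?thesis by (cases "quot_rank M N") auto
    qed
    have "quot_rank M N + enat 0 \<le> enat m" by (rule *[of _ undefined]) (simp_all add: indep_mod_def)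
    then obtain p where p: "quot_rank M N = enat p" "p \<le> m"
      by (cases "quot_rank M N") (auto simp flip: zero_enat_def)
    have "quot_rank N L \<le> enat (m - p)"
      unfolding quot_rank_def
    proof (rule SUP_least)
      fix q assume "q \<in> {n. \<exists>u. (\<forall>i<n. u i \<in> N) \<and> indep_mod L n u}"
      then have "p + q \<le> m" using * p by fastforce
      then show "enat q \<le> enat (m - p)" by simp
    qed
    then show ?thesis using p enat by (cases "quot_rank N L") auto
  qed simp
qed

lemma linear_dependence:
  fixes w :: "'j \<Rightarrow> nat \<Rightarrow> 'r::comm_ring_1"
  assumes nzd: "\<And>a b :: 'r. a * b = 0 \<Longrightarrow> a = 0 \<or> b = 0"
    and "finite J" "n < card J"
  shows "\<exists>g. (\<exists>j\<in>J. g j \<noteq> 0) \<and> (\<forall>k<n. (\<Sum>j\<in>J. g j * w j k) = 0)"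
  using assms(2,3)
proof (induction n arbitrary: J w)
  case 0
  then have "J \<noteq> {}" by auto
  then show ?case by (intro exI[of _ "\<lambda>_. 1"]) auto
next
  case (Suc n)
  show ?case
  proof (cases "\<forall>j\<in>J. w j n = 0")
    case True
    obtain g where g: "\<exists>j\<in>J. g j \<noteq> 0" "\<forall>k<n. (\<Sum>j\<in>J. g j * w j k) = 0"
      using Suc.IH[of J w] Suc.prems by auto
    then show ?thesis using True by (intro exI[of _ g]) (auto simp: less_Suc_eq)
  next
    case False
    then obtain p where p: "p \<in> J" "w p n \<noteq> 0" by blast
    let ?J = "J - {p}" and ?w = "\<lambda>j k. w p n * w j k - w j n * w p k"
    obtain g where g: "\<exists>j\<in>?J. g j \<noteq> 0" "\<forall>k<n. (\<Sum>j\<in>?J. g j * ?w j k) = 0"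
      using Suc.IH[of ?J ?w] Suc.prems p by (auto simp: less_diff_conv)
    let ?g = "\<lambda>j. if j = p then - (\<Sum>j\<in>?J. g j * w j n) else g j * w p n"
    have eq: "(\<Sum>j\<in>J. ?g j * w j k) = (\<Sum>j\<in>?J. g j * ?w j k)" for k
    proof -
      have "(\<Sum>j\<in>J. ?g j * w j k) = ?g p * w p k + (\<Sum>j\<in>?J. ?g j * w j k)"
        using Suc.prems p by (simp add: sum.remove)
      also have "(\<Sum>j\<in>?J. ?g j * w j k) = (\<Sum>j\<in>?J. g j * w p n * w j k)"
        by (intro sum.cong) auto
      finally have "(\<Sum>j\<in>J. ?g j * w j k) =
          (\<Sum>j\<in>?J. g j * w p n * w j k) - (\<Sum>j\<in>?J. g j * w j n) * w p k" by simp
      moreover have "(\<Sum>j\<in>?J. g j * ?w j k) =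
          (\<Sum>j\<in>?J. g j * w p n * w j k) - (\<Sum>j\<in>?J. g j * w j n) * w p k"
        by (simp add: sum_distrib_right right_diff_distrib sum_subtractf mult.assoc)
      ultimately show ?thesis by simp
    qed
    have "(\<Sum>j\<in>?J. g j * ?w j n) = 0" by (intro sum.neutral) (simp add: mult.commute)
    then have "\<forall>k<Suc n. (\<Sum>j\<in>J. ?g j * w j k) = 0"
      unfolding eq using g(2) by (auto simp: less_Suc_eq)
    moreover have "\<exists>j\<in>J. ?g j \<noteq> 0"
    proof -
      obtain j where "j \<in> ?J" "g j \<noteq> 0" using g(1) by blast
      then show ?thesis using nzd p(2) by (intro bexI[of _ j]) auto
    qed
    ultimately show ?thesis by (intro exI[of _ ?g] conjI)
  qed
qed

text \<open>If \<open>u\<close> is a maximal independent family, some nonzero multiple of each element is spanned by it.\<close>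

lemma maximal_indep_span:
  fixes M N :: "('i \<Rightarrow> 'r::comm_ring_1) set"
  assumes "quot_rank M N = enat p" "\<forall>i<p. u i \<in> M" "indep_mod N p u" "m \<in> M"
  obtains a c where "a \<noteq> 0" "(\<lambda>x. a * m x - (\<Sum>i<p. c i * u i x)) \<in> N"
proof -
  let ?u = "u(p := m)"
  have "\<not> indep_mod N (Suc p) ?u"
    using quot_rank_ge[of "Suc p" ?u M N] assms by (auto simp: less_Suc_eq)
  then obtain c j where c: "(\<lambda>x. \<Sum>i<Suc p. c i * ?u i x) \<in> N" "j < Suc p" "c j \<noteq> 0"
    unfolding indep_mod_def by blast
  have c': "(\<lambda>x. c p * m x + (\<Sum>i<p. c i * u i x)) \<in> N"
    using c(1) by (simp add: add.commute)
  have "c p \<noteq> 0"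
  proof
    assume "c p = 0"
    then have "(\<lambda>x. \<Sum>i<p. c i * u i x) \<in> N" using c' by simp
    then show False
      using c \<open>c p = 0\<close> assms(3) unfolding indep_mod_def by (metis less_SucE)
  qed
  then show ?thesis using that[of "c p" "\<lambda>i. - c i"] c' by (simp add: sum_negf)
qed

lemma quot_rank_subadditive:
  fixes L N M :: "('i \<Rightarrow> 'r::comm_ring_1) set"
  assumes nzd: "\<And>a b :: 'r. a * b = 0 \<Longrightarrow> a = 0 \<or> b = 0"
    and L: "left_submodule L"
  shows "quot_rank M L \<le> quot_rank M N + quot_rank N L"
proof (cases "quot_rank M N + quot_rank N L")
  case (enat s)
  then obtain p q where p: "quot_rank M N = enat p" and q: "quot_rank N L = enat q" and s: "s = p + q"
    by (cases "quot_rank M N"; cases "quot_rank N L") auto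
  obtain u where u: "\<forall>i<p. u i \<in> M" "indep_mod N p u" using quot_rank_enatE[OF p] by blast
  obtain v where v: "\<forall>i<q. v i \<in> N" "indep_mod L q v" using quot_rank_enatE[OF q] by blast
  have span: "\<exists>e c d. e \<noteq> 0 \<and> (\<lambda>x. e * m x - (\<Sum>i<p. c i * u i x) - (\<Sum>i<q. d i * v i x)) \<in> L"
    if m: "m \<in> M" for m
  proof -
    obtain a c where a: "a \<noteq> 0" "(\<lambda>x. a * m x - (\<Sum>i<p. c i * u i x)) \<in> N"
      using maximal_indep_span[OF p u m] by blast
    obtain b d where b: "b \<noteq> 0"
      "(\<lambda>x. b * (a * m x - (\<Sum>i<p. c i * u i x)) - (\<Sum>i<q. d i * v i x)) \<in> L"
      using maximal_indep_span[OF q v a(2)] by blast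
    have "(\<lambda>x. (b * a) * m x - (\<Sum>i<p. (b * c i) * u i x) - (\<Sum>i<q. d i * v i x)) \<in> L"
      using b(2) by (simp add: right_diff_distrib sum_distrib_left mult.assoc)
    moreover have "b * a \<noteq> 0" using nzd a(1) b(1) by blast
    ultimately show ?thesis by (intro exI[of _ "b * a"] exI[of _ "\<lambda>i. b * c i"] exI[of _ d]) simp
  qed
  have False if w: "\<forall>i<N'. w i \<in> M" "indep_mod L N' w" and big: "p + q < N'" for N' w
  proof -
    have "\<forall>j. \<exists>e c d. j < N' \<longrightarrow> e \<noteq> 0 \<and>
        (\<lambda>x. e * w j x - (\<Sum>i<p. c i * u i x) - (\<Sum>i<q. d i * v i x)) \<in> L"
      using span w(1) by blast
    from choice[OF this] obtain e where "\<forall>j. \<exists>c d. j < N' \<longrightarrow> e j \<noteq> 0 \<and>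
        (\<lambda>x. e j * w j x - (\<Sum>i<p. c i * u i x) - (\<Sum>i<q. d i * v i x)) \<in> L" ..
    from choice[OF this] obtain c where "\<forall>j. \<exists>d. j < N' \<longrightarrow> e j \<noteq> 0 \<and>
        (\<lambda>x. e j * w j x - (\<Sum>i<p. c j i * u i x) - (\<Sum>i<q. d i * v i x)) \<in> L" ..
    from choice[OF this] obtain d where ecd: "\<forall>j. j < N' \<longrightarrow> e j \<noteq> 0 \<and>
        (\<lambda>x. e j * w j x - (\<Sum>i<p. c j i * u i x) - (\<Sum>i<q. d j i * v i x)) \<in> L" ..
    then have e: "\<And>j. j < N' \<Longrightarrow> e j \<noteq> 0"
      and mem: "\<And>j. j < N' \<Longrightarrow>
        (\<lambda>x. e j * w j x - (\<Sum>i<p. c j i * u i x) - (\<Sum>i<q. d j i * v i x)) \<in> L" by auto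
    let ?c = "\<lambda>j k. if k < p then c j k else d j (k - p)"
    obtain g where g: "\<exists>j\<in>{..<N'}. g j \<noteq> 0" "\<forall>k<p + q. (\<Sum>j\<in>{..<N'}. g j * ?c j k) = 0"
      using linear_dependence[OF nzd, of "{..<N'}" "p + q" ?c, OF _ finite_lessThan] big
      unfolding card_lessThan by blast
    have gc: "(\<Sum>j<N'. g j * c j k) = 0" if "k < p" for k
      using g(2)[rule_format, of k] that by simp
    have gd: "(\<Sum>j<N'. g j * d j k) = 0" if "k < q" for k
      using g(2)[rule_format, of "p + k"] that by simp
    have swap: "(\<Sum>j<N'. g j * (\<Sum>i<r. f j i * t i x)) = (\<Sum>i<r. (\<Sum>j<N'. g j * f j i) * t i x)"
      for r and f :: "nat \<Rightarrow> nat \<Rightarrow> 'r" and t :: "nat \<Rightarrow> 'i \<Rightarrow> 'r" and x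
    proof -
      have "(\<Sum>j<N'. g j * (\<Sum>i<r. f j i * t i x)) = (\<Sum>j<N'. \<Sum>i<r. g j * f j i * t i x)"
        by (simp add: sum_distrib_left mult.assoc)
      also have "\<dots> = (\<Sum>i<r. \<Sum>j<N'. g j * f j i * t i x)" by (rule sum.swap)
      finally show ?thesis by (simp add: sum_distrib_right)
    qed
    have "(\<lambda>x. \<Sum>j<N'. g j * (e j * w j x - (\<Sum>i<p. c j i * u i x) - (\<Sum>i<q. d j i * v i x))) \<in> L"
      by (rule left_submodule_sum[OF L]) (use mem in auto)
    moreover have "(\<Sum>j<N'. g j * (e j * w j x - (\<Sum>i<p. c j i * u i x) - (\<Sum>i<q. d j i * v i x)))
        = (\<Sum>j<N'. (g j * e j) * w j x)" for x
    proof -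
      have "(\<Sum>j<N'. g j * (\<Sum>i<p. c j i * u i x)) = 0"
        unfolding swap by (rule sum.neutral) (simp add: gc)
      moreover have "(\<Sum>j<N'. g j * (\<Sum>i<q. d j i * v i x)) = 0"
        unfolding swap by (rule sum.neutral) (simp add: gd)
      ultimately show ?thesis
        by (simp only: right_diff_distrib sum_subtractf mult.assoc diff_0_right)
    qed
    ultimately have "(\<lambda>x. \<Sum>j<N'. (g j * e j) * w j x) \<in> L" by simp
    then have "\<forall>j<N'. g j * e j = 0"
      using w(2)[unfolded indep_mod_def, rule_format, of "\<lambda>j. g j * e j"] by blast
    then show False using g(1) e nzd by (metis lessThan_iff)
  qed
  then have "n \<le> p + q" if "\<forall>i<n. w i \<in> M" "indep_mod L n w" for n w
    using that by (meson not_less)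
  then have "quot_rank M L \<le> enat (p + q)"
    unfolding quot_rank_def[of M L] by (intro SUP_least) auto
  then show ?thesis using p q by simp
qed simp

lemma rank_additive_commutative_iff:
  "rank_additive TYPE('r::comm_ring_1) \<longleftrightarrow> (\<forall>a b :: 'r. a * b = 0 \<longrightarrow> a = 0 \<or> b = 0)"
    (is "_ \<longleftrightarrow> ?domain")
proof
  assume ?domain
  then have nzd: "\<And>a b :: 'r. a * b = 0 \<Longrightarrow> a = 0 \<or> b = 0" by blast
  have "quot_rank (free_module 1 :: (nat \<Rightarrow> 'r) set) {\<lambda>_. 0} = 1"
  proof (rule antisym)
    have "indep_mod {\<lambda>_. 0} 1 (\<lambda>_ i :: nat. if i = 0 then 1 else 0 :: 'r)"
      by (auto simp: indep_mod_def fun_eq_iff)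
    then show "1 \<le> quot_rank (free_module 1 :: (nat \<Rightarrow> 'r) set) {\<lambda>_. 0}"
      using quot_rank_ge[of 1 "\<lambda>_ i :: nat. if i = 0 then 1 else 0 :: 'r" "free_module 1" "{\<lambda>_. 0}"]
      by (simp add: free_module_def one_enat_def)
    show "quot_rank (free_module 1 :: (nat \<Rightarrow> 'r) set) {\<lambda>_. 0} \<le> 1"
      unfolding quot_rank_def
    proof (rule SUP_least)
      fix n assume "n \<in> {n. \<exists>u. (\<forall>i<n. u i \<in> (free_module 1 :: (nat \<Rightarrow> 'r) set))
        \<and> indep_mod {\<lambda>_. 0} n u}"
      then obtain u :: "nat \<Rightarrow> nat \<Rightarrow> 'r" where u: "\<forall>i<n. u i \<in> free_module 1" "indep_mod {\<lambda>_. 0} n u"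
        by blast
      show "enat n \<le> 1"
      proof (rule ccontr)
        assume "\<not> enat n \<le> 1"
        then have "1 < n" by (simp add: one_enat_def)
        then obtain g where g: "\<exists>j\<in>{..<n}. g j \<noteq> 0" "\<forall>k<1. (\<Sum>j\<in>{..<n}. g j * u j k) = 0"
          using linear_dependence[OF nzd, of "{..<n}" 1 u] by auto
        have "(\<Sum>j<n. g j * u j x) = 0" for x
          using g(2) u(1) by (cases "x = 0") (auto simp: free_module_def)
        then show False using g(1) u(2) by (auto simp: indep_mod_def)
      qed
    qed
  qed
  then show "rank_additive TYPE('r)"
    unfolding rank_additive_def
    using quot_rank_superadditive quot_rank_subadditive[OF nzd] by (blast intro: antisym)
next
  assume add: "rank_additive TYPE('r)"
  show ?domain
  proof (intro allI impI)
    fix a b :: 'r assume ab: "a * b = 0"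
    show "a = 0 \<or> b = 0"
    proof (cases "a = 0")
      case a: False
      let ?R = "free_module 1 :: (nat \<Rightarrow> 'r) set" and ?O = "{\<lambda>_. 0} :: (nat \<Rightarrow> 'r) set"
      let ?N = "{f \<in> ?R. \<exists>r. f 0 = a * r}"
      have sub: "left_submodule ?O" "left_submodule ?N" "left_submodule ?R"
        by (auto simp: left_submodule_def free_module_def)
          (metis mult_zero_right distrib_left mult.left_commute)+
      have "quot_rank ?R ?O = quot_rank ?R ?N + quot_rank ?N ?O"
      proof -
        have "?O \<subseteq> ?N" "?N \<subseteq> ?R" by (auto simp: free_module_def intro: exI[of _ 0])
        then show ?thesis
          using add[unfolded rank_additive_def, THEN conjunct2, rule_format, OF sub] by blast
      qed
      moreover have "quot_rank ?R ?N = 0"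
      proof -
        have "n = 0" if u: "\<forall>i<n. u i \<in> ?R" "indep_mod ?N n u" for n u
        proof (rule ccontr)
          assume "n \<noteq> 0"
          let ?c = "\<lambda>i. if i = 0 then a else 0"
          have "(\<Sum>i<n. ?c i * u i x) = a * u 0 x" for x
            using \<open>n \<noteq> 0\<close> sum.delta[of "{..<n}" 0 "\<lambda>i. a * u i x"]
            by (simp add: if_distrib[of "\<lambda>t. t * _"] cong: if_cong)
          then have eq: "(\<lambda>x. \<Sum>i<n. ?c i * u i x) = (\<lambda>x. a * u 0 x)" by blast
          have "(\<lambda>x. a * u 0 x) \<in> ?N"
            using u \<open>n \<noteq> 0\<close> by (auto simp: free_module_def)
          then have "(\<lambda>x. \<Sum>i<n. ?c i * u i x) \<in> ?N" by (simp only: eq)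
          then have "\<forall>i<n. ?c i = 0"
            using u(2)[unfolded indep_mod_def, THEN spec, of ?c] by blast
          then show False using a \<open>n \<noteq> 0\<close> by auto
        qed
        then have "quot_rank ?R ?N \<le> 0"
          unfolding quot_rank_def by (intro SUP_least) (auto simp: zero_enat_def)
        then show ?thesis by simp
      qed
      ultimately have "quot_rank ?N ?O = enat 1"
        using add by (simp add: rank_additive_def one_enat_def)
      then obtain u where u: "\<forall>i<1. u i \<in> ?N" "indep_mod ?O 1 u"
        using quot_rank_enatE by blast
      then obtain r where r: "u 0 0 = a * r" by auto
      have "b * (a * r) = 0" using ab by (metis mult.left_commute mult.assoc mult_zero_left)
      then have "b * u 0 x = 0" for x
        using u(1) r by (cases "x = 0") (auto simp: free_module_def)
      then have "b = 0"
        using u(2)[unfolded indep_mod_def, rule_format, of "\<lambda>_. b" 0] by auto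
      then show ?thesis ..
    qed simp
  qed
qed

corollary rank_additive_idom: "rank_additive TYPE('r::idom)"
  by (simp add: rank_additive_commutative_iff)

end

theory Submission
  imports Defs
begin

text \<open>
  Each \<open>A i\<close> is closed: the backward half of a solution through \<open>x\<^sup>\<star>\<close> continues into every face of
  \<open>x\<close>, and the order of the Morse decomposition bounds its \<open>\<omega>\<close>-limit set.  By the same argument
  \<open>U = A i - M i\<close> is closed.  No full solution runs in \<open>U - A (i - 1)\<close>, so this set can be exhausted
  by peeling off terminal regular multivectors and has no homology; hence the exact sequence of the
  pair \<open>(A i, U)\<close>, whose relative term is \<open>M i\<close>, relates the Poincare polynomials of \<open>A (i - 1)\<close>,
  \<open>M i\<close> and \<open>A i\<close>.  Its defect \<open>q i\<close> records the ranks of the connecting homomorphism, which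
  vanishes if no boundary coefficient leads from \<open>M i\<close> to \<open>U\<close>.
\<close>

section \<open>Rank of finitely generated modules\<close>

text \<open>\<open>rank_additive\<close> speaks only of submodules of finite free modules, so the
  exact sequence is used as a count of ranks and no homology module is ever mapped. Each homology
  rank becomes \<open>rk\<close> of cycles minus \<open>rk\<close> of boundaries. For a closed pair
  the ranks of chains add up, those of cycles fall short by a defect \<open>d q\<close>, and
  rank-nullity for the boundary operator turns this into an excess \<open>d (q + 1)\<close> of
  boundaries in degree \<open>q\<close>. The sum of the two defects is the origin of the factor
  \<open>1 + t\<close>. The quotient of the more obvious pair \<open>(A i, A (i - 1))\<close>
  contains, besides \<open>M i\<close>, cells of solutions on their way from \<open>M i\<close> down
  to lower Morse sets. Moving them into \<open>U\<close> leaves exactly \<open>M i\<close> as the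
  quotient and shows at the same time that \<open>M i\<close>, a difference of two closed sets, is a
  Lefschetz complex. Every index argument needs limit sets to be nonempty: disjointness of the Morse
  sets then makes the index of a limit set unique.\<close>

lemma the_enat_0 [simp]: "the_enat 0 = 0"
  by (simp add: zero_enat_def)

definition linear_map :: "(('i \<Rightarrow> 'r::ring_1) \<Rightarrow> 'j \<Rightarrow> 'r) \<Rightarrow> bool" where
  "linear_map f \<longleftrightarrow> (\<forall>u v. f (\<lambda>x. u x + v x) = (\<lambda>y. f u y + f v y))
     \<and> (\<forall>a u. f (\<lambda>x. a * u x) = (\<lambda>y. a * f u y))"

lemma linear_map_0:
  assumes "linear_map f"
  shows "f (\<lambda>_. 0) = (\<lambda>_. 0)"
proof -
  have "f (\<lambda>x. 0 * 0) = (\<lambda>y. 0 * f (\<lambda>_. 0) y)"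
    using assms unfolding linear_map_def by (elim conjE allE) assumption
  then show ?thesis by simp
qed

lemma linear_map_sum:
  assumes "linear_map f"
  shows "f (\<lambda>x. \<Sum>i<n. c i * u i x) = (\<lambda>y. \<Sum>i<n::nat. c i * f (u i) y)"
proof (induction n)
  case 0
  then show ?case by (simp add: linear_map_0[OF assms])
next
  case (Suc n)
  then show ?case using assms by (simp add: linear_map_def)
qed

lemma linear_map_image_submodule:
  assumes f: "linear_map f" and M: "left_submodule M"
  shows "left_submodule (f ` M)"
  unfolding left_submodule_def
proof (intro conjI ballI allI)
  show "(\<lambda>_. 0) \<in> f ` M"
    using M linear_map_0[OF f] image_eqI[of "\<lambda>_. 0" f "\<lambda>_. 0" M] by (simp add: left_submodule_def)
next
  fix g h assume "g \<in> f ` M" "h \<in> f ` M"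
  then obtain u v where "u \<in> M" "g = f u" "v \<in> M" "h = f v" by blast
  then have "(\<lambda>x. g x + h x) = f (\<lambda>x. u x + v x)" "(\<lambda>x. u x + v x) \<in> M"
    using f left_submodule_add[OF M] by (simp_all add: linear_map_def)
  then show "(\<lambda>x. g x + h x) \<in> f ` M" by simp
next
  fix a g assume "g \<in> f ` M"
  then obtain u where "u \<in> M" "g = f u" by blast
  then have "(\<lambda>x. a * g x) = f (\<lambda>x. a * u x)" "(\<lambda>x. a * u x) \<in> M"
    using f left_submodule_scale[OF M] by (simp_all add: linear_map_def)
  then show "(\<lambda>x. a * g x) \<in> f ` M" by simp
qed

lemma linear_map_restrict: "linear_map (\<lambda>c x. if x \<in> C then c x else 0)"
  by (auto simp: linear_map_def)

text \<open>Within \<open>M\<close>, the set \<open>N\<close> is the preimage of \<open>N'\<close>.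
  A linear combination thus lies in \<open>N\<close> exactly if its image lies in \<open>N'\<close>,
  so independent families can be pushed forward along \<open>f\<close> and lifted back.\<close>

lemma quot_rank_iso:
  assumes f: "linear_map f" and M: "left_submodule M"
    and N: "\<And>m. m \<in> M \<Longrightarrow> f m \<in> N' \<longleftrightarrow> m \<in> N"
  shows "quot_rank M N = quot_rank (f ` M) N'"
proof -
  have "(\<exists>u. (\<forall>i<n. u i \<in> M) \<and> indep_mod N n u) \<longleftrightarrow>
      (\<exists>v. (\<forall>i<n. v i \<in> f ` M) \<and> indep_mod N' n v)" (is "?L \<longleftrightarrow> ?R") for n
  proof -
    have *: "indep_mod N' n (\<lambda>i. f (u i)) \<longleftrightarrow> indep_mod N n u" if u: "\<forall>i<n. u i \<in> M" for u
    proof -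
      have "(\<lambda>y. \<Sum>i<n. c i * f (u i) y) \<in> N' \<longleftrightarrow> (\<lambda>x. \<Sum>i<n. c i * u i x) \<in> N" for c
        unfolding linear_map_sum[OF f, symmetric]
        by (rule N, rule left_submodule_sum[OF M]) (use u in auto)
      then show ?thesis by (simp add: indep_mod_def)
    qed
    show ?thesis
    proof
      assume ?L
      then obtain u where "\<forall>i<n. u i \<in> M" "indep_mod N n u" by blast
      then show ?R using * by (intro exI[of _ "\<lambda>i. f (u i)"]) simp
    next
      assume ?R
      then obtain v where v: "\<forall>i<n. v i \<in> f ` M" "indep_mod N' n v" by blast
      then have "\<forall>i. \<exists>m. i < n \<longrightarrow> m \<in> M \<and> v i = f m" by blast
      from choice[OF this] obtain u where u: "\<forall>i. i < n \<longrightarrow> u i \<in> M \<and> v i = f (u i)" ..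
      have "(\<lambda>x. \<Sum>i<n. c i * v i x) = (\<lambda>x. \<Sum>i<n. c i * f (u i) x)" for c
        using u by auto
      then have "indep_mod N' n (\<lambda>i. f (u i))" using v(2) by (simp add: indep_mod_def)
      then show ?L using *[of u] u by (intro exI[of _ u]) simp
    qed
  qed
  then show ?thesis by (simp add: quot_rank_def)
qed

text \<open>Taking all coefficients 1 gives a relation modulo \<open>M\<close>, and 1 differs from 0
  in \<open>ring_1\<close>, so only the empty family is independent.\<close>

lemma quot_rank_same:
  assumes "left_submodule M"
  shows "quot_rank M M = 0"
proof -
  have "n = 0" if u: "\<forall>i<n. u i \<in> M" "indep_mod M n u" for n u
  proof -
    have "(\<lambda>x. \<Sum>i<n. 1 * u i x) \<in> M"
      by (rule left_submodule_sum[OF assms]) (use u(1) in auto)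
    then have "\<forall>i<n. (1 :: 'b) = 0"
      using u(2)[unfolded indep_mod_def, rule_format, of "\<lambda>_. 1"] by blast
    then show ?thesis by auto
  qed
  then have "quot_rank M M \<le> 0"
    unfolding quot_rank_def by (intro SUP_least) (auto simp: zero_enat_def)
  then show ?thesis by simp
qed

definition supported :: "'x set \<Rightarrow> ('x \<Rightarrow> 'r::ring_1) set" where
  "supported F = {c. \<forall>x. x \<notin> F \<longrightarrow> c x = 0}"

lemma left_submodule_supported: "left_submodule (supported F)"
  by (auto simp: left_submodule_def supported_def)

lemma left_submodule_zero: "left_submodule {\<lambda>_. 0}"
  by (auto simp: left_submodule_def)

text \<open>\<open>rank_additive\<close> is stated for the index type \<open>nat\<close>. An
  enumeration of the finite set \<open>F\<close> embeds \<open>M\<close> into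
  \<open>free_module (card F)\<close> and transports the three quotients.\<close>

lemma quot_rank_additive:
  fixes L N M :: "('x \<Rightarrow> 'r::ring_1) set"
  assumes ra: "rank_additive TYPE('r)" and F: "finite F"
    and sub: "left_submodule L" "left_submodule N" "left_submodule M"
    and LNM: "L \<subseteq> N" "N \<subseteq> M" "M \<subseteq> supported F"
  shows "quot_rank M L = quot_rank M N + quot_rank N L"
proof -
  obtain g where g: "bij_betw g {..<card F} F"
    using ex_bij_betw_nat_finite[OF F] atLeast0LessThan by metis
  define f :: "('x \<Rightarrow> 'r) \<Rightarrow> nat \<Rightarrow> 'r" where "f c = (\<lambda>i. if i < card F then c (g i) else 0)" for c
  have lin: "linear_map f" by (auto simp: linear_map_def f_def)
  have inj: "u = v" if "u \<in> M" "v \<in> M" "f u = f v" for u v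
  proof
    fix x show "u x = v x"
    proof (cases "x \<in> F")
      case True
      then obtain i where "i < card F" "x = g i" using g unfolding bij_betw_def by auto
      then show ?thesis using fun_cong[OF that(3), of i] by (simp add: f_def)
    next
      case False
      have "u \<in> supported F" "v \<in> supported F" using that LNM(3) by blast+
      then show ?thesis using False by (simp add: supported_def)
    qed
  qed
  have iso: "quot_rank A B = quot_rank (f ` A) (f ` B)"
    if "left_submodule A" "A \<subseteq> M" "B \<subseteq> A" for A B
  proof (rule quot_rank_iso[OF lin that(1)])
    fix m assume "m \<in> A"
    then show "f m \<in> f ` B \<longleftrightarrow> m \<in> B" using inj that(2,3) by (auto simp: subset_iff)
  qed
  have "f ` M \<subseteq> free_module (card F)" by (auto simp: free_module_def f_def)
  then have "quot_rank (f ` M) (f ` L) = quot_rank (f ` M) (f ` N) + quot_rank (f ` N) (f ` L)"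
    using ra[unfolded rank_additive_def, THEN conjunct2, rule_format,
        OF linear_map_image_submodule[OF lin sub(1)] linear_map_image_submodule[OF lin sub(2)]
          linear_map_image_submodule[OF lin sub(3)]] LNM
    by (meson image_mono)
  moreover have "L \<subseteq> M" using LNM by blast
  ultimately show ?thesis using iso[of M L] iso[of M N] iso[of N L] sub LNM by simp
qed

text \<open>Equations in \<open>enat\<close> can be cancelled only at finite values. Evaluation at
  the new point \<open>a\<close> has kernel \<open>supported F\<close> and image
  \<open>free_module 1\<close>, whose rank is 1 by the first clause of
  \<open>rank_additive\<close>.\<close>

lemma quot_rank_supported_finite:
  assumes ra: "rank_additive TYPE('r::ring_1)" and "finite F"
  shows "quot_rank (supported F :: ('x \<Rightarrow> 'r) set) {\<lambda>_. 0} \<noteq> \<infinity>"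
  using assms(2)
proof (induction F rule: finite_induct)
  case empty
  have "(supported {} :: ('x \<Rightarrow> 'r) set) = {\<lambda>_. 0}" by (auto simp: supported_def)
  then show ?case by (simp only: quot_rank_same[OF left_submodule_zero]) simp
next
  case (insert a F)
  let ?S = "supported (insert a F) :: ('x \<Rightarrow> 'r) set"
  define f :: "('x \<Rightarrow> 'r) \<Rightarrow> nat \<Rightarrow> 'r" where "f c = (\<lambda>i. if i = 0 then c a else 0)" for c
  have "supported F \<subseteq> ?S" by (auto simp: supported_def)
  moreover have "{\<lambda>_. 0} \<subseteq> (supported F :: ('x \<Rightarrow> 'r) set)" by (simp add: supported_def)
  ultimately have "quot_rank ?S {\<lambda>_. 0} = quot_rank ?S (supported F)
      + quot_rank (supported F :: ('x \<Rightarrow> 'r) set) {\<lambda>_. 0}"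
    using quot_rank_additive[OF ra _ left_submodule_zero left_submodule_supported left_submodule_supported,
        of "insert a F" F "insert a F"] insert(1) by simp
  moreover have "quot_rank ?S (supported F) = quot_rank (f ` ?S) {\<lambda>_. 0}"
  proof (rule quot_rank_iso)
    show "linear_map f" by (auto simp: linear_map_def f_def)
    show "f m \<in> {\<lambda>_. 0} \<longleftrightarrow> m \<in> supported F" if "m \<in> ?S" for m
      using that insert(2) by (auto simp: f_def supported_def fun_eq_iff)
  qed (rule left_submodule_supported)
  moreover have "f ` ?S = free_module 1"
  proof
    show "free_module 1 \<subseteq> f ` ?S"
    proof
      fix g :: "nat \<Rightarrow> 'r" assume "g \<in> free_module 1"
      then have "g = f (\<lambda>x. if x = a then g 0 else 0)"
        by (auto simp: f_def free_module_def fun_eq_iff)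
      then show "g \<in> f ` ?S" by (auto simp: supported_def)
    qed
  qed (auto simp: f_def free_module_def)
  ultimately have "quot_rank ?S {\<lambda>_. 0} = 1 + quot_rank (supported F :: ('x \<Rightarrow> 'r) set) {\<lambda>_. 0}"
    using ra[unfolded rank_additive_def, THEN conjunct1] by simp
  then show ?case
    using insert.IH by (simp add: plus_eq_infty_iff_enat)
qed

text \<open>Integer-valued so that ranks can be subtracted. It is applied to modules of functions
  with finite support, whose rank is finite by the preceding lemma.\<close>

definition rk :: "('x \<Rightarrow> 'r::ring_1) set \<Rightarrow> int" where
  "rk M = int (the_enat (quot_rank M {\<lambda>_. 0}))"

lemma rk_nonneg: "0 \<le> rk M"
  by (simp add: rk_def)

text \<open>Additivity along the zero module, \<open>L\<close> and \<open>M\<close>. The rank of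
  \<open>M\<close> is a summand of the finite rank of \<open>supported F\<close>, which allows the
  subtraction.\<close>

lemma rk_quot:
  fixes L M :: "('x \<Rightarrow> 'r::ring_1) set"
  assumes ra: "rank_additive TYPE('r)" and F: "finite F"
    and sub: "left_submodule L" "left_submodule M" and LM: "L \<subseteq> M" "M \<subseteq> supported F"
  shows "int (the_enat (quot_rank M L)) = rk M - rk L"
proof -
  let ?O = "{\<lambda>_. 0} :: ('x \<Rightarrow> 'r) set"
  have "?O \<subseteq> L" using sub by (auto simp: left_submodule_def)
  then have "quot_rank M ?O = quot_rank M L + quot_rank L ?O"
    using quot_rank_additive[OF ra F left_submodule_zero sub] LM by blast
  moreover have "quot_rank (supported F) ?O = quot_rank (supported F) M + quot_rank M ?O"
    using quot_rank_additive[OF ra F left_submodule_zero sub(2) left_submodule_supported] LM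
      \<open>?O \<subseteq> L\<close> by blast
  then have "quot_rank M ?O \<noteq> \<infinity>"
    using quot_rank_supported_finite[OF ra F] by (metis plus_eq_infty_iff_enat)
  ultimately show ?thesis
    by (cases "quot_rank M L"; cases "quot_rank L ?O") (auto simp: rk_def)
qed

lemma rk_mono:
  fixes L M :: "('x \<Rightarrow> 'r::ring_1) set"
  assumes "rank_additive TYPE('r)" "finite F" "left_submodule L" "left_submodule M"
    and "L \<subseteq> M" "M \<subseteq> supported F"
  shows "rk L \<le> rk M"
  using rk_quot[OF assms] by linarith

lemma rk_nullity:
  fixes M :: "('x \<Rightarrow> 'r::ring_1) set"
  assumes ra: "rank_additive TYPE('r)" and F: "finite F"
    and f: "linear_map f" and M: "left_submodule M" "M \<subseteq> supported F"
  shows "rk M = rk {m \<in> M. f m = (\<lambda>_. 0)} + rk (f ` M)"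
proof -
  have "left_submodule {m \<in> M. f m = (\<lambda>_. 0)}"
    using M(1) f linear_map_0[OF f] unfolding left_submodule_def linear_map_def by auto
  moreover have "quot_rank M {m \<in> M. f m = (\<lambda>_. 0)} = quot_rank (f ` M) {\<lambda>_. 0}"
    by (rule quot_rank_iso[OF f M(1)]) auto
  ultimately show ?thesis
    using rk_quot[OF ra F _ M(1) _ M(2), of "{m \<in> M. f m = (\<lambda>_. 0)}"] by (auto simp: rk_def)
qed

section \<open>Homology of a closed pair\<close>

lemma subcomplex_simps [simp]:
  "cells (subcomplex K A) = A" "dm (subcomplex K A) = dm K" "kappa (subcomplex K A) = kappa K"
  "subcomplex (subcomplex K A) B = subcomplex K B"
  by (simp_all add: subcomplex_def)

lemma subcomplex_cells [simp]: "subcomplex K (cells K) = K"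
  by (simp add: subcomplex_def)

lemma linear_map_bd: "linear_map (bd K)"
  by (auto simp: linear_map_def bd_def fun_eq_iff distrib_right sum.distrib sum_distrib_left mult.assoc)

lemma chains_submodule: "left_submodule (chains K q)"
proof -
  have "chains K q = supported {x \<in> cells K. dm K x = q}"
    by (auto simp: chains_def supported_def)
  then show ?thesis by (simp add: left_submodule_supported)
qed

lemma chains_supported: "chains K q \<subseteq> supported (cells K)"
  by (auto simp: chains_def supported_def)

lemma cycles_submodule: "left_submodule (cycles K q)"
  using chains_submodule[of K q] linear_map_bd[of K] linear_map_0[OF linear_map_bd, of K]
  unfolding left_submodule_def linear_map_def cycles_def by auto

lemma cycles_supported: "cycles K q \<subseteq> supported (cells K)"
  using chains_supported by (auto simp: cycles_def)

lemma boundaries_submodule: "left_submodule (boundaries K q)"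
  unfolding boundaries_def by (rule linear_map_image_submodule[OF linear_map_bd chains_submodule])

lemma bd_chains:
  assumes "lefschetz_complex K" "c \<in> chains K (q + 1)"
  shows "bd K c \<in> chains K q"
proof -
  have "dm K y = q" if y: "y \<in> cells K" "(\<Sum>x\<in>cells K. c x * kappa K x y) \<noteq> 0" for y
  proof -
    obtain x where x: "x \<in> cells K" "c x * kappa K x y \<noteq> 0"
      using y(2) by (meson sum.neutral)
    then have "c x \<noteq> 0" "kappa K x y \<noteq> 0" by auto
    then have "dm K x = q + 1" "dm K x = dm K y + 1"
      using assms x(1) y(1) by (auto simp: lefschetz_complex_def chains_def)
    then show ?thesis by simp
  qed
  then show ?thesis by (auto simp: chains_def bd_def)
qed

lemma bd_bd:
  assumes "lefschetz_complex K"
  shows "bd K (bd K c) = (\<lambda>_. 0)"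
proof
  fix z
  show "bd K (bd K c) z = 0"
  proof (cases "z \<in> cells K")
    case True
    have "bd K (bd K c) z = (\<Sum>y\<in>cells K. \<Sum>x\<in>cells K. c x * (kappa K x y * kappa K y z))"
      using True by (simp add: bd_def sum_distrib_right mult.assoc)
    also have "\<dots> = (\<Sum>x\<in>cells K. c x * (\<Sum>y\<in>cells K. kappa K x y * kappa K y z))"
      by (subst sum.swap) (simp add: sum_distrib_left)
    also have "\<dots> = 0" using assms True by (simp add: lefschetz_complex_def)
    finally show ?thesis .
  qed (simp add: bd_def)
qed

lemma boundaries_subset_cycles:
  assumes "lefschetz_complex K"
  shows "boundaries K q \<subseteq> cycles K q"
  using bd_chains[OF assms] bd_bd[OF assms] by (auto simp: boundaries_def cycles_def)

lemma homology_rank_eq: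
  fixes K :: "('x, 'r::ring_1) lefschetz"
  assumes "rank_additive TYPE('r)" "lefschetz_complex K"
  shows "int (the_enat (homology_rank K q)) = rk (cycles K q) - rk (boundaries K q)"
  unfolding homology_rank_def
  by (rule rk_quot[OF assms(1), of "cells K"])
    (use assms(2) in \<open>auto simp: lefschetz_complex_def boundaries_submodule cycles_submodule
      boundaries_subset_cycles[OF assms(2), THEN subsetD] cycles_supported[THEN subsetD]\<close>)

lemma rk_chains_Suc:
  fixes K :: "('x, 'r::ring_1) lefschetz"
  assumes "rank_additive TYPE('r)" "lefschetz_complex K"
  shows "rk (chains K (q + 1)) = rk (cycles K (q + 1)) + rk (boundaries K q)"
  using rk_nullity[OF assms(1) _ linear_map_bd chains_submodule chains_supported, of K "q + 1" K] assms(2)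
  by (simp add: cycles_def boundaries_def lefschetz_complex_def)

lemma chains_trivial:
  assumes "q \<notin> dm K ` cells K"
  shows "chains K q = {\<lambda>_. 0}"
  using assms by (auto simp: chains_def)

lemma rk_zero: "rk {\<lambda>_. 0 :: 'r::ring_1} = 0"
  by (simp add: rk_def quot_rank_same[OF left_submodule_zero])

lemma cycles_trivial:
  assumes "q \<notin> dm K ` cells K"
  shows "cycles K q = {\<lambda>_. 0}"
  using chains_trivial[OF assms] linear_map_0[OF linear_map_bd, of K] by (auto simp: cycles_def)

text \<open>\<open>poincare\<close> sums only over dimensions of cells. In every other degree cycles
  and boundaries are both zero, so the formula is available uniformly in \<open>q\<close>.\<close>

lemma coeff_poincare:
  fixes K :: "('x, 'r::ring_1) lefschetz"
  assumes ra: "rank_additive TYPE('r)" and K: "lefschetz_complex K"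
  shows "coeff (poincare K) q = rk (cycles K q) - rk (boundaries K q)"
proof -
  have fin: "finite (dm K ` cells K)" using K by (simp add: lefschetz_complex_def)
  have "coeff (poincare K) q =
      (if q \<in> dm K ` cells K then int (the_enat (homology_rank K q)) else 0)"
    unfolding poincare_def coeff_sum coeff_monom using fin by simp
  moreover have "rk (cycles K q) - rk (boundaries K q) = 0" if "q \<notin> dm K ` cells K"
  proof -
    have "boundaries K q = {\<lambda>_. 0}"
      using boundaries_subset_cycles[OF K, of q] cycles_trivial[OF that] boundaries_submodule[of K q]
      by (auto simp: left_submodule_def)
    then show ?thesis using cycles_trivial[OF that] by simp
  qed
  ultimately show ?thesis using homology_rank_eq[OF ra K] by auto
qed

lemma poincare_zero_homology:
  fixes K :: "('x, 'r::ring_1) lefschetz"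
  assumes "zero_homology K"
  shows "poincare K = 0"
  using assms
  by (simp add: poincare_def homology_rank_def zero_homology_def quot_rank_same[OF boundaries_submodule])

text \<open>Closedness phrased by incidence coefficients instead of the face order: this is what the
  boundary operator sees, and it passes to subcomplexes without comparing two face orders.\<close>

definition face_closed :: "('x, 'r::ring_1) lefschetz \<Rightarrow> 'x set \<Rightarrow> bool" where
  "face_closed K B \<longleftrightarrow> B \<subseteq> cells K \<and> (\<forall>x\<in>B. \<forall>y\<in>cells K - B. kappa K x y = 0)"

text \<open>The third assumption kills each term of the composite boundary that passes through a
  removed cell, so the sum over \<open>A\<close> equals the vanishing sum over all cells.\<close>

lemma lefschetz_subcomplex:
  assumes "lefschetz_complex K" "A \<subseteq> cells K"
    and "\<And>x y z. x \<in> A \<Longrightarrow> z \<in> A \<Longrightarrow> y \<in> cells K - A \<Longrightarrow> kappa K x y * kappa K y z = 0"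
  shows "lefschetz_complex (subcomplex K A)"
proof -
  have "(\<Sum>y\<in>A. kappa K x y * kappa K y z) = 0" if "x \<in> A" "z \<in> A" for x z
  proof -
    have "(\<Sum>y\<in>A. kappa K x y * kappa K y z) = (\<Sum>y\<in>cells K. kappa K x y * kappa K y z)"
      by (rule sum.mono_neutral_left) (use assms that in \<open>auto simp: lefschetz_complex_def\<close>)
    moreover have "x \<in> cells K" "z \<in> cells K" using assms(2) that by blast+
    ultimately show ?thesis using assms(1) by (simp add: lefschetz_complex_def)
  qed
  then show ?thesis
    using assms by (auto simp: lefschetz_complex_def finite_subset subset_iff)
qed

text \<open>On a detour through a removed cell, the outgoing coefficient vanishes if the carrier is
  \<open>B\<close>, the returning one if it is the complement.\<close>

lemma lefschetz_face_closed:
  assumes "lefschetz_complex K" "face_closed K B"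
  shows "lefschetz_complex (subcomplex K B)" "lefschetz_complex (subcomplex K (cells K - B))"
  by (rule lefschetz_subcomplex[OF assms(1)]; use assms(2) in \<open>auto simp: face_closed_def\<close>)+

text \<open>The rank form of the exact sequence of a closed pair. The coefficient of
  \<open>Q\<close> in degree \<open>k\<close> is the rank of the connecting homomorphism out of
  degree \<open>k + 1\<close>; the last two clauses are the two situations in which that map has
  rank 0.\<close>

lemma closed_pair_poincare:
  fixes K :: "('x, 'r::ring_1) lefschetz"
  assumes ra: "rank_additive TYPE('r)" and K: "lefschetz_complex K" and B: "face_closed K B"
  obtains Q :: "int poly" where "\<forall>k. 0 \<le> coeff Q k"
    "poincare (subcomplex K B) + poincare (subcomplex K (cells K - B)) = poincare K + [:1, 1:] * Q"
    "poincare (subcomplex K (cells K - B)) = 0 \<longrightarrow> Q = 0"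
    "(\<forall>x\<in>cells K - B. \<forall>y\<in>B. kappa K x y = 0) \<longrightarrow> Q = 0"
proof -
  define C where "C = cells K - B"
  define KB where "KB = subcomplex K B"
  define KC where "KC = subcomplex K C"
  note KB = lefschetz_face_closed(1)[OF K B, folded KB_def]
  note KC = lefschetz_face_closed(2)[OF K B, folded C_def KC_def]
  have BK: "B \<subseteq> cells K" and CB: "\<And>x y. x \<in> B \<Longrightarrow> y \<in> C \<Longrightarrow> kappa K x y = 0"
    using B by (auto simp: face_closed_def C_def)
  have [simp]: "cells KB = B" "cells KC = C" "dm KB = dm K" "dm KC = dm K"
    "kappa KB = kappa K" "kappa KC = kappa K"
    by (simp_all add: KB_def KC_def)
  have fin: "finite (cells K)" using K by (simp add: lefschetz_complex_def)
  \<comment> \<open>Relative chains are modelled by chains on \<open>C\<close>, and \<open>f\<close>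
    is the projection onto them: a surjective chain map whose kernel is the chain complex of
    \<open>B\<close>.\<close>
  define f :: "('x \<Rightarrow> 'r) \<Rightarrow> 'x \<Rightarrow> 'r" where "f c = (\<lambda>x. if x \<in> C then c x else 0)" for c
  have f: "linear_map f" unfolding f_def by (rule linear_map_restrict)
  have f_chains: "f ` chains K q = chains KC q" for q
  proof
    show "chains KC q \<subseteq> f ` chains K q"
    proof
      fix c assume "c \<in> chains KC q"
      then have "c = f c" "c \<in> chains K q" by (auto simp: f_def chains_def C_def fun_eq_iff)
      then show "c \<in> f ` chains K q" by blast
    qed
  qed (auto simp: chains_def f_def split: if_splits)
  have bd_f: "bd KC (f c) = f (bd K c)" for c
  proof -
    have "(\<Sum>x\<in>C. f c x * kappa K x y) = (\<Sum>x\<in>cells K. c x * kappa K x y)" if "y \<in> C" for y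
      by (rule sum.mono_neutral_cong_left) (use fin that CB in \<open>auto simp: f_def C_def\<close>)
    then show ?thesis by (auto simp: bd_def f_def fun_eq_iff C_def)
  qed
  have ker: "{c \<in> chains K q. f c = (\<lambda>_. 0)} = chains KB q" for q
    using BK by (auto simp: chains_def f_def C_def fun_eq_iff)
  have bd_B: "bd KB c = bd K c" if "c \<in> chains KB q" for c q
  proof -
    have c0: "c x = 0" if "x \<notin> B" for x
      using \<open>c \<in> chains KB q\<close> that by (auto simp: chains_def)
    have "(\<Sum>x\<in>cells K. c x * kappa K x y) = (\<Sum>x\<in>B. c x * kappa K x y)" for y
      by (rule sum.mono_neutral_right) (use fin BK in \<open>auto simp: c0\<close>)
    moreover have "(\<Sum>x\<in>B. c x * kappa K x y) = 0" if "y \<in> C" for y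
      using CB that by (intro sum.neutral) auto
    ultimately show ?thesis using BK by (auto simp: bd_def fun_eq_iff C_def)
  qed
  have ker_cycles: "{c \<in> cycles K q. f c = (\<lambda>_. 0)} = cycles KB q" for q
  proof -
    have "c \<in> cycles K q \<and> f c = (\<lambda>_. 0) \<longleftrightarrow> c \<in> cycles KB q" for c
      using bd_B[of c q] ker[of q, THEN eqset_imp_iff, of c] by (auto simp: cycles_def)
    then show ?thesis by blast
  qed
  \<comment> \<open>The relative cycles that lift to cycles of \<open>K\<close>; modulo boundaries
    this is the kernel of the connecting homomorphism.\<close>
  define I where "I q = f ` cycles K q" for q
  have I_sub: "left_submodule (I q)" for q
    unfolding I_def by (rule linear_map_image_submodule[OF f cycles_submodule])
  have I_cycles: "I q \<subseteq> cycles KC q" for q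
    using f_chains[of q] by (auto simp: I_def cycles_def bd_f linear_map_0[OF f])
  have bd_I: "boundaries KC q \<subseteq> I q" for q
    unfolding boundaries_def f_chains[symmetric] I_def
    using boundaries_subset_cycles[OF K, of q] by (auto simp: bd_f boundaries_def)
  \<comment> \<open>the rank of the connecting homomorphism from degree \<open>q\<close> of the quotient to degree \<open>q - 1\<close> of \<open>B\<close>\<close>
  define d where "d q = rk (cycles KC q) - rk (I q)" for q
  note mono = rk_mono[OF ra]
  have finC: "finite C" using fin by (simp add: C_def)
  have d_nonneg: "0 \<le> d q" for q
    using mono[OF finC I_sub cycles_submodule I_cycles] cycles_supported[of KC] by (simp add: d_def)
  have IC: "I q \<subseteq> supported C" for q using I_cycles cycles_supported[of KC] by fastforce
  \<comment> \<open>Since \<open>I q\<close> lies between the boundaries and the cycles of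
    \<open>KC\<close>, the defect is at most the rank of the relative homology. This is why
    \<open>Q\<close> vanishes with the polynomial of the quotient.\<close>
  have d_le: "d q \<le> coeff (poincare KC) q" for q
    using mono[OF finC boundaries_submodule I_sub bd_I IC]
    by (simp add: d_def coeff_poincare[OF ra KC])
  have chains_add: "rk (chains K q) = rk (chains KB q) + rk (chains KC q)" for q
    using rk_nullity[OF ra fin f chains_submodule chains_supported, of q] by (simp add: ker f_chains)
  have cycles_add: "rk (cycles K q) = rk (cycles KB q) + rk (cycles KC q) - d q" for q
    using rk_nullity[OF ra fin f cycles_submodule cycles_supported, of q]
    by (simp add: ker_cycles d_def I_def)
  have cycles0: "cycles L 0 = chains L 0" if "lefschetz_complex L" for L :: "('x, 'r) lefschetz"
  proof -
    have "c x * kappa L x y = 0" if "c \<in> chains L 0" "y \<in> cells L" "x \<in> cells L" for c x y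
    proof (rule ccontr)
      assume "c x * kappa L x y \<noteq> 0"
      then have "c x \<noteq> 0" "kappa L x y \<noteq> 0" by auto
      then have "dm L x = 0" "dm L x = dm L y + 1"
        using that \<open>lefschetz_complex L\<close> by (auto simp: chains_def lefschetz_complex_def)
      then show False by simp
    qed
    then show ?thesis by (auto simp: cycles_def bd_def intro!: sum.neutral)
  qed
  \<comment> \<open>The product of \<open>1 + t\<close> and \<open>Q\<close> has only
    \<open>d 1\<close> in degree 0, whereas the count produces \<open>d 0 + d 1\<close>. In degree 0
    every chain is a cycle, so there is no defect.\<close>
  have d0: "d 0 = 0"
    using cycles_add[of 0] chains_add[of 0] by (simp add: cycles0 K KB KC)
  \<comment> \<open>A bound on the dimensions that makes \<open>Q\<close> a finite sum; inserting 0
    keeps \<open>Max\<close> defined for the empty complex.\<close>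
  define m where "m = Max (insert 0 (dm K ` cells K))"
  have m: "\<forall>x\<in>cells K. dm K x \<le> m" using fin by (simp add: m_def)
  have d_large: "d q = 0" if "q > m" for q
  proof -
    have "q \<notin> dm KC ` cells KC" using that m by (fastforce simp: C_def)
    then have "cycles KC q = {\<lambda>_. 0}" by (rule cycles_trivial)
    then show ?thesis using d_nonneg[of q] rk_nonneg[of "I q"] by (simp add: d_def rk_zero)
  qed
  define Q where "Q = (\<Sum>k\<le>m. monom (d (Suc k)) k)"
  have coeff_Q: "coeff Q k = d (Suc k)" for k
    using d_large[of "Suc k"] by (simp add: Q_def coeff_sum)
  have "coeff (poincare KB + poincare KC) k = coeff (poincare K + [:1, 1:] * Q) k" for k
  proof -
    have "coeff ([:1, 1:] * Q) k = d (Suc k) + d k"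
      using d0 by (cases k) (simp_all add: coeff_Q)
    then show ?thesis
      using rk_chains_Suc[OF ra K, of k] rk_chains_Suc[OF ra KB, of k] rk_chains_Suc[OF ra KC, of k]
        chains_add[of "k + 1"] cycles_add[of "k + 1"] cycles_add[of k]
      by (simp add: coeff_poincare[OF ra] K KB KC)
  qed
  then have "poincare KB + poincare KC = poincare K + [:1, 1:] * Q" by (rule poly_eqI)
  moreover have "Q = 0" if "poincare KC = 0"
    using d_le d_nonneg that by (intro poly_eqI) (simp add: coeff_Q order.antisym)
  \<comment> \<open>Without incidences from \<open>C\<close> to \<open>B\<close>, a relative cycle
    has no boundary in \<open>B\<close> and is itself a cycle of \<open>K\<close>; hence
    \<open>I q\<close> is all of \<open>cycles KC q\<close>.\<close>
  moreover have "Q = 0" if BC: "\<forall>x\<in>C. \<forall>y\<in>B. kappa K x y = 0"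
  proof -
    have "cycles KC q \<subseteq> I q" for q
    proof
      fix c assume c: "c \<in> cycles KC q"
      then have fc: "f c = c" and ch: "c \<in> chains K q" by (auto simp: f_def cycles_def chains_def C_def fun_eq_iff)
      have "bd K c y = 0" for y
      proof (cases "y \<in> C")
        case True
        have "bd K c y = f (bd K c) y" using True by (simp add: f_def)
        also have "\<dots> = bd KC c y" by (simp add: fc flip: bd_f)
        also have "\<dots> = 0" using c by (simp add: cycles_def)
        finally show ?thesis .
      next
        case False
        have "c x = 0" if "x \<notin> C" for x using c that by (auto simp: cycles_def chains_def)
        then have "c x * kappa K x y = 0" if "y \<in> cells K" for x
          using False that BC by (cases "x \<in> C") (auto simp: C_def)
        then show ?thesis by (auto simp: bd_def intro: sum.neutral)
      qed
      then have "c \<in> cycles K q" using ch by (auto simp: cycles_def)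
      then show "c \<in> I q" using fc unfolding I_def by (metis imageI)
    qed
    then have "I q = cycles KC q" for q using I_cycles[of q] by blast
    then have "d q = 0" for q by (simp add: d_def)
    then show ?thesis by (intro poly_eqI) (simp add: coeff_Q)
  qed
  ultimately show ?thesis
    using that[of Q] d_nonneg by (simp add: coeff_Q KB_def KC_def C_def)
qed

section \<open>The face order\<close>

definition facets :: "('x, 'r::ring_1) lefschetz \<Rightarrow> 'x rel" where
  "facets K = {(y, x). x \<in> cells K \<and> y \<in> cells K \<and> kappa K x y \<noteq> 0}"

lemma facets_rtrancl_dm:
  assumes "lefschetz_complex K" "(y, x) \<in> (facets K)\<^sup>*"
  shows "dm K y < dm K x \<or> y = x"
  using assms(2)
proof (induction rule: rtrancl_induct)
  case (step w x)
  then have "dm K x = dm K w + 1" using assms(1) by (auto simp: facets_def lefschetz_complex_def)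
  then show ?case using step.IH by auto
qed simp

text \<open>Dimension rises strictly along facets, so their reflexive transitive closure is
  antisymmetric and is itself one of the orders being intersected. The restriction to cells is
  needed because \<open>rtrancl\<close> is reflexive on the whole type.\<close>

lemma face_order_eq:
  assumes K: "lefschetz_complex K"
  shows "face_order K = {(y, x). y \<in> cells K \<and> x \<in> cells K \<and> (y, x) \<in> (facets K)\<^sup>*}" (is "_ = ?R")
proof
  have "antisym ?R"
  proof (rule antisymI)
    fix x y assume "(x, y) \<in> ?R" "(y, x) \<in> ?R"
    then show "x = y" using facets_rtrancl_dm[OF K, of x y] facets_rtrancl_dm[OF K, of y x] by auto
  qed
  moreover have "trans ?R" by (rule transI) auto
  ultimately have "partial_order_on (cells K) ?R"
    by (auto simp: partial_order_on_def preorder_on_def refl_on_def)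
  moreover have "(y, x) \<in> ?R" if "x \<in> cells K" "y \<in> cells K" "kappa K x y \<noteq> 0" for x y
    using that by (auto simp: facets_def)
  ultimately show "face_order K \<subseteq> ?R" unfolding face_order_def by (intro Inter_lower) blast
  show "?R \<subseteq> face_order K"
  proof
    fix p assume "p \<in> ?R"
    then obtain y x where p: "p = (y, x)" "y \<in> cells K" "(y, x) \<in> (facets K)\<^sup>*" by blast
    have "(y, x) \<in> r" if r: "partial_order_on (cells K) r"
      "\<forall>x\<in>cells K. \<forall>y\<in>cells K. kappa K x y \<noteq> 0 \<longrightarrow> (y, x) \<in> r" for r
      using p(3)
    proof (induction rule: rtrancl_induct)
      case base
      then show ?case using r(1) p(2) by (auto simp: partial_order_on_def preorder_on_def refl_on_def)
    next
      case (step w x)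
      then have "(w, x) \<in> r" using r(2) by (auto simp: facets_def)
      moreover have "trans r" using r(1) by (simp add: partial_order_on_def preorder_on_def)
      ultimately show ?case using step.IH by (meson transD)
    qed
    then show "p \<in> face_order K" by (simp add: face_order_def p(1))
  qed
qed

lemma face_dm:
  assumes "lefschetz_complex K" "(y, x) \<in> face_order K"
  shows "dm K y < dm K x \<or> y = x"
  using facets_rtrancl_dm[OF assms(1), of y x] assms(2) by (simp add: face_order_eq[OF assms(1)])

lemma face_refl: "lefschetz_complex K \<Longrightarrow> x \<in> cells K \<Longrightarrow> (x, x) \<in> face_order K"
  by (simp add: face_order_eq)

lemma face_trans:
  "lefschetz_complex K \<Longrightarrow> (z, y) \<in> face_order K \<Longrightarrow> (y, x) \<in> face_order K \<Longrightarrow> (z, x) \<in> face_order K"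
  by (auto simp: face_order_eq)

lemma face_cells:
  "lefschetz_complex K \<Longrightarrow> (y, x) \<in> face_order K \<Longrightarrow> y \<in> cells K \<and> x \<in> cells K"
  by (simp add: face_order_eq)

lemma face_kappa:
  "lefschetz_complex K \<Longrightarrow> x \<in> cells K \<Longrightarrow> y \<in> cells K \<Longrightarrow> kappa K x y \<noteq> 0 \<Longrightarrow> (y, x) \<in> face_order K"
  by (auto simp: face_order_eq facets_def)

lemma in_cl_singleton:
  "lefschetz_complex K \<Longrightarrow> y \<in> cl K {x} \<longleftrightarrow> (y, x) \<in> face_order K"
  using face_cells[of K y x] by (auto simp: cl_def)

text \<open>A face \<open>z\<close> of a cell \<open>y\<close> of \<open>mo K A\<close> always lies
  in \<open>cl K A\<close>. It can leave \<open>mo K A\<close> only by belonging to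
  \<open>A\<close>, and then \<open>y\<close> is a gap between two cells of
  \<open>A\<close>.\<close>

lemma proper_iff_convex:
  assumes K: "lefschetz_complex K"
  shows "proper K A \<longleftrightarrow> A \<subseteq> cells K \<and>
    (\<forall>z\<in>A. \<forall>x\<in>A. \<forall>y. (z, y) \<in> face_order K \<longrightarrow> (y, x) \<in> face_order K \<longrightarrow> y \<in> A)"
    (is "_ \<longleftrightarrow> _ \<and> ?convex")
proof -
  have "cl K (mo K A) = mo K A \<longleftrightarrow> ?convex" if A: "A \<subseteq> cells K"
  proof
    assume closed: "cl K (mo K A) = mo K A"
    show ?convex
    proof (intro ballI allI impI)
      fix z x y assume zx: "z \<in> A" "x \<in> A" and zy: "(z, y) \<in> face_order K" and yx: "(y, x) \<in> face_order K"
      show "y \<in> A"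
      proof (rule ccontr)
        assume "y \<notin> A"
        then have "y \<in> mo K A" using zx yx face_cells[OF K yx] by (auto simp: mo_def cl_def)
        then have "z \<in> cl K (mo K A)" using zy face_cells[OF K zy] by (auto simp: cl_def)
        then have "z \<in> mo K A" using closed by simp
        then show False using zx by (simp add: mo_def)
      qed
    qed
  next
    assume convex: ?convex
    show "cl K (mo K A) = mo K A"
    proof
      show "mo K A \<subseteq> cl K (mo K A)"
      proof
        fix y assume "y \<in> mo K A"
        moreover from this have "y \<in> cells K" by (simp add: mo_def cl_def)
        ultimately show "y \<in> cl K (mo K A)" using face_refl[OF K] by (auto simp: cl_def)
      qed
      show "cl K (mo K A) \<subseteq> mo K A"
      proof
        fix z assume "z \<in> cl K (mo K A)"
        then obtain y where y: "z \<in> cells K" "y \<in> mo K A" "(z, y) \<in> face_order K" by (auto simp: cl_def)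
        then obtain x where x: "x \<in> A" "(y, x) \<in> face_order K" "y \<notin> A" by (auto simp: mo_def cl_def)
        then have "z \<notin> A" using convex y by blast
        moreover have "z \<in> cl K A" using face_trans[OF K y(3) x(2)] x(1) y(1) by (auto simp: cl_def)
        ultimately show "z \<in> mo K A" by (simp add: mo_def)
      qed
    qed
  qed
  then show ?thesis by (auto simp: proper_def)
qed

lemma lefschetz_proper:
  assumes K: "lefschetz_complex K" and A: "proper K A"
  shows "lefschetz_complex (subcomplex K A)"
proof (rule lefschetz_subcomplex[OF K])
  show "A \<subseteq> cells K" using A by (simp add: proper_def)
  fix x y z assume xz: "x \<in> A" "z \<in> A" and y: "y \<in> cells K - A"
  show "kappa K x y * kappa K y z = 0"
  proof (rule ccontr)
    assume "kappa K x y * kappa K y z \<noteq> 0"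
    then have "kappa K x y \<noteq> 0" "kappa K y z \<noteq> 0" by auto
    then have "(y, x) \<in> face_order K" "(z, y) \<in> face_order K"
      using xz y \<open>A \<subseteq> cells K\<close> by (auto intro!: face_kappa[OF K])
    then show False using A xz y unfolding proper_iff_convex[OF K] by blast
  qed
qed

text \<open>By convexity a chain of facets between two cells of \<open>A\<close> never leaves
  \<open>A\<close>, so no relation is lost when the order is generated anew inside
  \<open>A\<close>.\<close>

lemma face_order_subcomplex:
  assumes K: "lefschetz_complex K" and A: "proper K A"
  shows "face_order (subcomplex K A) = face_order K \<inter> A \<times> A"
proof -
  note KA = lefschetz_proper[OF K A]
  have sub: "A \<subseteq> cells K"
    and convex: "\<And>z y x. \<lbrakk>z \<in> A; x \<in> A; (z, y) \<in> face_order K; (y, x) \<in> face_order K\<rbrakk> \<Longrightarrow> y \<in> A"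
    using A unfolding proper_iff_convex[OF K] by blast+
  have "(y, x) \<in> (facets (subcomplex K A))\<^sup>*" if y: "y \<in> A" and yx: "(y, x) \<in> (facets K)\<^sup>*" and x: "x \<in> A" for y x
    using yx x
  proof (induction rule: rtrancl_induct)
    case (step w x)
    have "w \<in> cells K" using step.hyps by (auto simp: facets_def)
    moreover have "x \<in> cells K" "y \<in> cells K" using step.prems y sub by blast+
    ultimately have "(y, w) \<in> face_order K" "(w, x) \<in> face_order K"
      using step.hyps by (auto simp: face_order_eq[OF K])
    then have "w \<in> A" using convex[OF y step.prems] by blast
    moreover from this have "(w, x) \<in> facets (subcomplex K A)"
      using step by (simp add: facets_def)
    ultimately show ?case using step.IH by (meson rtrancl.rtrancl_into_rtrancl)
  qed simp
  moreover have "(facets (subcomplex K A))\<^sup>* \<subseteq> (facets K)\<^sup>*"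
    using sub by (intro rtrancl_mono) (auto simp: facets_def)
  ultimately show ?thesis
    using sub by (auto simp: face_order_eq[OF K] face_order_eq[OF KA])
qed

section \<open>Multivector fields and solutions\<close>

locale mv_field =
  fixes K :: "('x, 'r::ring_1) lefschetz" and W :: "'x set set"
  assumes lefschetz: "lefschetz_complex K" and field: "multivector_field K W"
begin

lemma finite_cells: "finite (cells K)"
  using lefschetz by (simp add: lefschetz_complex_def)

lemma mv_of_eq:
  assumes "V \<in> W" "x \<in> V"
  shows "mv_of W x = V"
  unfolding mv_of_def
proof (rule the_equality)
  fix U assume "U \<in> W \<and> x \<in> U"
  then show "U = V" using field assms
    unfolding multivector_field_def partition_on_def disjoint_def by blast
qed (use assms in simp)

lemma
  assumes "x \<in> cells K"
  shows mv_of_in: "mv_of W x \<in> W" and in_mv_of: "x \<in> mv_of W x"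
proof -
  obtain V where "V \<in> W" "x \<in> V"
    using field assms unfolding multivector_field_def partition_on_def by blast
  then show "mv_of W x \<in> W" "x \<in> mv_of W x" using mv_of_eq by auto
qed

lemma mv_of_cells:
  assumes "x \<in> cells K"
  shows "mv_of W x \<subseteq> cells K"
  using mv_of_in[OF assms] field unfolding multivector_field_def partition_on_def by blast

lemma mv_of_cong:
  assumes "x \<in> cells K" "y \<in> mv_of W x"
  shows "mv_of W y = mv_of W x"
  using mv_of_eq[OF mv_of_in[OF assms(1)] assms(2)] .

lemma star_cong:
  assumes "x \<in> cells K" "y \<in> mv_of W x"
  shows "star K W y = star K W x"
  by (simp add: star_def mv_of_cong[OF assms])

text \<open>Among the finitely many cells of \<open>V\<close> above \<open>v\<close>, one of largest
  dimension is maximal, since proper faces have smaller dimension.\<close>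

lemma maximal_above:
  assumes "V \<subseteq> cells K" "v \<in> V"
  obtains w where "is_maximal K V w" "(v, w) \<in> face_order K"
proof -
  let ?A = "{w \<in> V. (v, w) \<in> face_order K}"
  have fin: "finite ?A" using finite_subset[OF assms(1) finite_cells] by simp
  have "v \<in> ?A" using assms face_refl[OF lefschetz] by blast
  then have "Max (dm K ` ?A) \<in> dm K ` ?A" using fin by (intro Max_in) auto
  then obtain w where w: "w \<in> ?A" "dm K w = Max (dm K ` ?A)" by auto
  have "u = w" if u: "u \<in> V" "(w, u) \<in> face_order K" for u
  proof -
    have "u \<in> ?A" using u w(1) face_trans[OF lefschetz] by blast
    then have "dm K u \<le> dm K w" unfolding w(2) using fin by (intro Max_ge) auto
    then show ?thesis using face_dm[OF lefschetz u(2)] by auto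
  qed
  then have "is_maximal K V w" using w(1) by (simp add: is_maximal_def)
  then show ?thesis using that w(1) by blast
qed

text \<open>Every cell of a multivector lies below some maximal one, so uniqueness of the maximal
  cell makes it the greatest.\<close>

lemma
  assumes x: "x \<in> cells K"
  shows star_in: "star K W x \<in> mv_of W x"
    and face_star: "v \<in> mv_of W x \<Longrightarrow> (v, star K W x) \<in> face_order K"
proof -
  have ex1: "\<exists>!m. is_maximal K (mv_of W x) m"
    using mv_of_in[OF x] field by (simp add: multivector_field_def multivector_def)
  have max: "is_maximal K (mv_of W x) (star K W x)" unfolding star_def by (rule theI'[OF ex1])
  then show "star K W x \<in> mv_of W x" by (simp add: is_maximal_def)
  assume "v \<in> mv_of W x"
  then obtain w where "is_maximal K (mv_of W x) w" "(v, w) \<in> face_order K"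
    using maximal_above[OF mv_of_cells[OF x]] by blast
  then show "(v, star K W x) \<in> face_order K" using max ex1 by blast
qed

lemma star_cells: "x \<in> cells K \<Longrightarrow> star K W x \<in> cells K"
  using star_in mv_of_cells by blast

lemma star_star: "x \<in> cells K \<Longrightarrow> star K W (star K W x) = star K W x"
  using star_cong star_in by blast

lemma mv_of_star: "x \<in> cells K \<Longrightarrow> mv_of W (star K W x) = mv_of W x"
  using mv_of_cong star_in by blast

lemma Pi_not_star:
  assumes "x \<in> cells K" "x \<noteq> star K W x"
  shows "Pi_mv K W x = {star K W x}"
  using assms star_cells[OF assms(1)] by (auto simp: Pi_mv_def)

lemma Pi_star_cases:
  assumes "x \<in> cells K" "y \<in> Pi_mv K W x"
  shows "y = star K W x \<or> (y, x) \<in> face_order K"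
  using assms by (auto simp: Pi_mv_def in_cl_singleton[OF lefschetz])

text \<open>The bridge from faces to dynamics: \<open>x\<close> lies below its dominant cell, so a
  face of \<open>x\<close> outside the multivector is also a face of \<open>star K W x\<close>, from
  which a step to it is allowed.\<close>

lemma Pi_star_face:
  assumes "x \<in> cells K" "(y, x) \<in> face_order K" "y \<notin> mv_of W x"
  shows "y \<in> Pi_mv K W (star K W x)"
proof -
  have "(y, star K W x) \<in> face_order K"
    using face_trans[OF lefschetz assms(2) face_star[OF assms(1) in_mv_of[OF assms(1)]]] .
  then show ?thesis
    using assms face_cells[OF lefschetz assms(2)]
    by (simp add: Pi_mv_def star_star mv_of_star in_cl_singleton[OF lefschetz])
qed

text \<open>Multivectors partition the cells, so a compatible set contains each of them entirely or
  not at all, and the dominant cell decides which.\<close>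

lemma compatible_star:
  assumes "compatible K W N" "x \<in> cells K"
  shows "star K W x \<in> N \<longleftrightarrow> x \<in> N"
proof
  assume "star K W x \<in> N"
  then have "mv_of W (star K W x) \<subseteq> N" using assms(1) by (simp add: compatible_def)
  then show "x \<in> N" using in_mv_of assms(2) by (auto simp: mv_of_star)
next
  assume "x \<in> N"
  then show "star K W x \<in> N" using assms star_in unfolding compatible_def by blast
qed

lemma compatible_mv_of:
  assumes "compatible K W N" "x \<in> cells K" "y \<in> mv_of W x"
  shows "y \<in> N \<longleftrightarrow> x \<in> N"
  using compatible_star[OF assms(1,2)] compatible_star[OF assms(1), of y] star_cong[OF assms(2,3)]
    mv_of_cells[OF assms(2)] assms(3) by auto

lemma compatibleI_star:
  assumes "N \<subseteq> cells K" "\<And>x. x \<in> cells K \<Longrightarrow> star K W x \<in> N \<longleftrightarrow> x \<in> N"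
  shows "compatible K W N"
  unfolding compatible_def
proof (intro conjI ballI subsetI)
  fix x y assume x: "x \<in> N" and y: "y \<in> mv_of W x"
  then have "x \<in> cells K" "y \<in> cells K" using assms(1) mv_of_cells by blast+
  then show "y \<in> N" using assms(2)[of x] assms(2)[of y] x star_cong y by auto
qed (use assms in auto)

lemma compatible_diff:
  assumes "compatible K W N" "compatible K W N'"
  shows "compatible K W (N - N')"
  by (rule compatibleI_star) (use assms compatible_star in \<open>auto simp: compatible_def\<close>)

lemma compatible_cells: "compatible K W (cells K)"
  using mv_of_cells by (auto simp: compatible_def)

lemma lower_hull_subset: "lower_hull K W N \<subseteq> N"
  by (auto simp: lower_hull_def)

lemma compatible_lower_hull: "compatible K W (lower_hull K W N)"
  unfolding lower_hull_def compatible_def by blast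

lemma lower_hull_compatible: "compatible K W N \<Longrightarrow> lower_hull K W N = N"
  unfolding lower_hull_def by blast

lemma upper_hull_subset: "N \<subseteq> upper_hull K W N"
  unfolding upper_hull_def by blast

lemma upper_hull_least: "compatible K W B \<Longrightarrow> N \<subseteq> B \<Longrightarrow> upper_hull K W N \<subseteq> B"
  unfolding upper_hull_def by blast

lemma upper_hull_mono: "N \<subseteq> N' \<Longrightarrow> upper_hull K W N \<subseteq> upper_hull K W N'"
  unfolding upper_hull_def by blast

lemma compatible_upper_hull:
  assumes "N \<subseteq> cells K"
  shows "compatible K W (upper_hull K W N)"
  using compatible_cells assms unfolding upper_hull_def compatible_def by blast

section \<open>Invariant parts and invariant sets\<close>

lemma Inv_subset: "Inv K W N \<subseteq> N"
  by (auto simp: Inv_def)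

lemma Inv_mono:
  assumes "N \<subseteq> N'"
  shows "Inv K W N \<subseteq> Inv K W N'"
proof -
  have "lower_hull K W N \<subseteq> lower_hull K W N'" using assms unfolding lower_hull_def by blast
  then show ?thesis using assms unfolding Inv_def Sol_def by blast
qed

lemma in_Inv:
  assumes "compatible K W N"
  shows "x \<in> Inv K W N \<longleftrightarrow> x \<in> N \<and> (\<exists>\<phi>. full_solution K W \<phi> \<and> range \<phi> \<subseteq> N \<and> star K W x \<in> range \<phi>)"
  by (auto simp: Inv_def Sol_def lower_hull_compatible[OF assms])

text \<open>The solution that witnesses membership in \<open>Inv\<close> runs in the largest
  compatible subset, which therefore contains the dominant cell and with it the whole
  multivector.\<close>

lemma compatible_invariant:
  assumes "invariant K W N"
  shows "compatible K W N"
  unfolding compatible_def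
proof (intro conjI ballI)
  show N: "N \<subseteq> cells K" using assms by (simp add: invariant_def)
  fix x assume x: "x \<in> N"
  then have "x \<in> Inv K W N" using assms by (simp add: invariant_def)
  then have "star K W x \<in> lower_hull K W N" by (auto simp: Inv_def Sol_def)
  then have "x \<in> lower_hull K W N"
    using compatible_star[OF compatible_lower_hull] x N by blast
  then have "mv_of W x \<subseteq> lower_hull K W N" using compatible_lower_hull by (simp add: compatible_def)
  then show "mv_of W x \<subseteq> N" using lower_hull_subset by blast
qed

lemma invariant_solution:
  assumes "invariant K W N" "x \<in> N"
  obtains \<phi> a where "full_solution K W \<phi>" "range \<phi> \<subseteq> N" "\<phi> a = star K W x"
proof -
  have "x \<in> Inv K W N" using assms by (simp add: invariant_def)
  then obtain \<phi> where "full_solution K W \<phi>" "range \<phi> \<subseteq> N" "star K W x \<in> range \<phi>"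
    unfolding in_Inv[OF compatible_invariant[OF assms(1)]] by blast
  then show ?thesis using that by (metis imageE)
qed

text \<open>Invariance provides a solution through the dominant cell, not through \<open>x\<close>.
  If \<open>x\<close> is not dominant, its only step leads to the dominant cell, so \<open>x\<close>
  can be put in front.\<close>

lemma invariant_forward_solution:
  assumes N: "invariant K W N" and x: "x \<in> N"
  obtains \<sigma> where "solution K W {0..} \<sigma>" "\<sigma> ` {0..} \<subseteq> N" "\<sigma> 0 = x"
proof -
  obtain \<phi> a where \<phi>: "full_solution K W \<phi>" "range \<phi> \<subseteq> N" "\<phi> a = star K W x"
    using invariant_solution[OF assms] .
  have xc: "x \<in> cells K" using assms by (auto simp: invariant_def)
  have step: "\<phi> (t + 1) \<in> Pi_mv K W (\<phi> t)" for t using \<phi>(1) by (simp add: solution_def)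
  show ?thesis
  proof (cases "x = star K W x")
    case True
    have "\<phi> (a + (t + 1)) \<in> Pi_mv K W (\<phi> (a + t))" for t using step[of "a + t"] by (simp add: add.assoc)
    moreover have "\<phi> (a + t) \<in> cells K" for t using \<phi>(1) by (auto simp: solution_def)
    ultimately have "solution K W {0..} (\<lambda>t. \<phi> (a + t))" by (auto simp: solution_def)
    then show ?thesis using that[of "\<lambda>t. \<phi> (a + t)"] \<phi>(2,3) True by auto
  next
    case False
    \<comment> \<open>The shift by one places \<open>\<phi> a\<close>, the dominant cell, at time
      1.\<close>
    let ?\<sigma> = "\<lambda>t. if t = 0 then x else \<phi> (a + t - 1)"
    have "?\<sigma> (t + 1) \<in> Pi_mv K W (?\<sigma> t)" if "0 \<le> t" for t
      using step[of "a + t - 1"] that Pi_not_star[OF xc False] \<phi>(3) by (auto simp: add.assoc)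
    moreover have "\<phi> t \<in> cells K" for t using \<phi>(1) by (auto simp: solution_def)
    ultimately have "solution K W {0..} ?\<sigma>" using xc by (auto simp: solution_def)
    then show ?thesis using that[of ?\<sigma>] \<phi>(2) x by auto
  qed
qed

lemma solution_glue:
  assumes \<rho>: "full_solution K W \<rho>" and \<sigma>: "solution K W {0..} \<sigma>" and step: "\<sigma> 0 \<in> Pi_mv K W (\<rho> a)"
  shows "full_solution K W (\<lambda>t. if t \<le> a then \<rho> t else \<sigma> (t - a - 1))" (is "full_solution K W ?\<phi>")
proof -
  have "?\<phi> (t + 1) \<in> Pi_mv K W (?\<phi> t)" for t
  proof -
    consider "t < a" | "t = a" | "t > a" by linarith
    then show ?thesis
    proof cases
      case 3
      then have "\<sigma> ((t - a - 1) + 1) \<in> Pi_mv K W (\<sigma> (t - a - 1))"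
        using \<sigma>[unfolded solution_def, THEN conjunct2, rule_format, of "t - a - 1"] by simp
      then show ?thesis using 3 by (simp add: algebra_simps)
    qed (use \<rho> step in \<open>auto simp: solution_def\<close>)
  qed
  then show ?thesis using \<rho> \<sigma> by (auto simp: solution_def)
qed

text \<open>Time is reduced modulo \<open>b - a\<close>; the equal end values make the step at the
  wrap-around legal.\<close>

lemma solution_periodic:
  assumes \<phi>: "solution K W {a..b} \<phi>" and ab: "a < b" "\<phi> a = \<phi> b"
  obtains \<psi> where "full_solution K W \<psi>" "range \<psi> \<subseteq> \<phi> ` {a..b}" "\<phi> a \<in> range \<psi>"
proof -
  define p where "p = b - a"
  define \<psi> where "\<psi> t = \<phi> (a + t mod p)" for t
  have p: "p > 0" using ab by (simp add: p_def)
  have range: "a + t mod p \<in> {a..b}" for t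
  proof -
    have "t mod p < b - a" using pos_mod_bound[OF p, of t] by (simp add: p_def)
    then show ?thesis using pos_mod_sign[OF p, of t] by simp
  qed
  have "\<psi> (t + 1) \<in> Pi_mv K W (\<psi> t)" for t
  proof -
    have eq: "\<psi> (t + 1) = \<phi> (a + t mod p + 1)"
    proof (cases "t mod p + 1 < p")
      case True
      have "(t + 1) mod p = (t mod p + 1) mod p" by (simp add: mod_add_left_eq)
      also have "\<dots> = t mod p + 1"
        by (rule mod_pos_pos_trivial) (use True pos_mod_sign[OF p, of t] in auto)
      finally show ?thesis by (simp add: \<psi>_def add.assoc)
    next
      case False
      then have m: "t mod p + 1 = p" using pos_mod_bound[OF p, of t] by linarith
      have "(t + 1) mod p = (t mod p + 1) mod p" by (simp add: mod_add_left_eq)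
      then have "\<psi> (t + 1) = \<phi> a" by (simp add: \<psi>_def m)
      moreover have "a + t mod p + 1 = b" using m by (simp add: p_def)
      ultimately show ?thesis using ab by simp
    qed
    have "t mod p < b - a" using pos_mod_bound[OF p, of t] by (simp add: p_def)
    then have "a + t mod p + 1 \<in> {a..b}" using range[of t] by simp
    then have "\<phi> (a + t mod p + 1) \<in> Pi_mv K W (\<phi> (a + t mod p))"
      using \<phi> range[of t] unfolding solution_def by auto
    then show ?thesis unfolding eq by (simp add: \<psi>_def)
  qed
  moreover have "range \<psi> \<subseteq> \<phi> ` {a..b}" using range by (auto simp: \<psi>_def)
  moreover from this have "range \<psi> \<subseteq> cells K" using \<phi> by (auto simp: solution_def)
  moreover have "\<phi> a = \<psi> 0" by (simp add: \<psi>_def)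
  ultimately show ?thesis using that[of \<psi>] unfolding solution_def by auto
qed

text \<open>The loop has to pass through the dominant cell of \<open>x\<close>. If \<open>x\<close>
  is not dominant, that cell is the value right after each visit to \<open>x\<close>, so the loop is
  taken one step later; this explains the window up to \<open>t + 1\<close>.\<close>

lemma recurrent_in_Inv:
  assumes \<phi>: "full_solution K W \<phi>" and st: "s < t" "\<phi> s = x" "\<phi> t = x"
    and H: "compatible K W H" "\<phi> ` {s..t + 1} \<subseteq> H"
  shows "x \<in> Inv K W H"
proof -
  have step: "\<phi> (t + 1) \<in> Pi_mv K W (\<phi> t)" for t using \<phi> by (simp add: solution_def)
  have x: "x \<in> cells K" using \<phi> st by (auto simp: solution_def)
  have "\<exists>a b. s \<le> a \<and> a < b \<and> b \<le> t + 1 \<and> \<phi> a = star K W x \<and> \<phi> b = star K W x"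
  proof (cases "x = star K W x")
    case True then show ?thesis using st by (intro exI[of _ s] exI[of _ t]) auto
  next
    case False
    then have "\<phi> (s + 1) = star K W x" "\<phi> (t + 1) = star K W x"
      using step[of s] step[of t] st Pi_not_star[OF x False] by auto
    then show ?thesis using st by (intro exI[of _ "s + 1"] exI[of _ "t + 1"]) auto
  qed
  then obtain a b where ab: "s \<le> a" "a < b" "b \<le> t + 1" "\<phi> a = star K W x" "\<phi> b = star K W x" by blast
  have "solution K W {a..b} \<phi>" using \<phi> by (auto simp: solution_def)
  then obtain \<psi> where \<psi>: "full_solution K W \<psi>" "range \<psi> \<subseteq> \<phi> ` {a..b}" "\<phi> a \<in> range \<psi>"
    using solution_periodic[of a b \<phi>] ab by auto
  have "\<phi> ` {a..b} \<subseteq> \<phi> ` {s..t + 1}" using ab by (intro image_mono) auto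
  then have "range \<psi> \<subseteq> H" using \<psi>(2) H(2) by (meson order.trans)
  moreover have "x \<in> H"
  proof -
    have "\<phi> s \<in> \<phi> ` {s..t + 1}" using st(1) by (intro imageI) simp
    then show ?thesis using H(2) st(2) by (metis subsetD)
  qed
  moreover have "star K W x \<in> range \<psi>" using \<psi>(3) ab(4) by simp
  ultimately show ?thesis unfolding in_Inv[OF H(1)] using \<psi>(1) by (intro conjI exI[of _ \<psi>])
qed

section \<open>Limit sets of full solutions\<close>

lemma alpha_limit_subset:
  assumes "compatible K W N" "\<phi> ` {..a} \<subseteq> N"
  shows "alpha_limit K W \<phi> \<subseteq> N"
proof -
  have "- int (nat \<bar>a\<bar>) \<le> a" by simp
  then have "\<phi> ` {..- int (nat \<bar>a\<bar>)} \<subseteq> N" using assms(2) by (auto simp: image_subset_iff)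
  then have "Inv K W (upper_hull K W (\<phi> ` {..- int (nat \<bar>a\<bar>)})) \<subseteq> N"
    using upper_hull_least[OF assms(1)] Inv_subset by blast
  then show ?thesis unfolding alpha_limit_def by blast
qed

lemma omega_limit_subset:
  assumes "compatible K W N" "\<phi> ` {a..} \<subseteq> N"
  shows "omega_limit K W \<phi> \<subseteq> N"
proof -
  have "a \<le> int (nat \<bar>a\<bar>)" by simp
  then have "\<phi> ` {int (nat \<bar>a\<bar>)..} \<subseteq> N" using assms(2) by (auto simp: image_subset_iff)
  then have "Inv K W (upper_hull K W (\<phi> ` {int (nat \<bar>a\<bar>)..})) \<subseteq> N"
    using upper_hull_least[OF assms(1)] Inv_subset by blast
  then show ?thesis unfolding omega_limit_def by blast
qed

text \<open>The sets in the intersection shrink as \<open>k\<close> grows, so only the distant past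
  matters. This allows a solution to be cut and continued differently without changing its
  \<open>\<alpha>\<close>-limit set.\<close>

lemma alpha_limit_cong:
  assumes "\<And>t. t \<le> a \<Longrightarrow> \<phi> t = \<psi> t"
  shows "alpha_limit K W \<phi> = alpha_limit K W \<psi>"
proof -
  have *: "alpha_limit K W \<phi> \<subseteq> alpha_limit K W \<psi>" if eq: "\<And>t. t \<le> a \<Longrightarrow> \<phi> t = \<psi> t" for \<phi> \<psi>
    unfolding alpha_limit_def[of _ _ \<psi>]
  proof (rule INT_greatest)
    fix k :: nat
    define l where "l = max k (nat \<bar>a\<bar>)"
    have "- int l \<le> a" "- int l \<le> - int k" by (auto simp: l_def)
    then have "\<phi> ` {..- int l} = \<psi> ` {..- int l}" "\<psi> ` {..- int l} \<subseteq> \<psi> ` {..- int k}"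
      using eq by (auto intro!: image_cong)
    then have "Inv K W (upper_hull K W (\<phi> ` {..- int l})) \<subseteq> Inv K W (upper_hull K W (\<psi> ` {..- int k}))"
      by (intro Inv_mono upper_hull_mono) simp
    then show "alpha_limit K W \<phi> \<subseteq> Inv K W (upper_hull K W (\<psi> ` {..- int k}))"
      unfolding alpha_limit_def by blast
  qed
  show ?thesis using *[of \<phi> \<psi>] *[of \<psi> \<phi>] assms by (simp add: subset_antisym)
qed

lemma recurrent_value:
  fixes f :: "nat \<Rightarrow> 'x"
  assumes "range f \<subseteq> cells K"
  obtains x where "\<And>m. \<exists>n>m. f n = x"
proof -
  have "finite (range f)" using finite_subset[OF assms finite_cells] .
  then obtain n0 where "infinite {n \<in> UNIV. f n = f n0}"
    using pigeonhole_infinite[of UNIV f] by auto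
  then show ?thesis using that[of "f n0"] by (auto simp: infinite_nat_iff_unbounded)
qed

text \<open>Finiteness gives a cell visited infinitely often in the past. Two visits far enough back
  bound a loop inside any given tail, and \<open>n > k\<close> leaves room for the extra step
  required by \<open>recurrent_in_Inv\<close>.\<close>

lemma alpha_limit_nonempty:
  assumes \<phi>: "full_solution K W \<phi>"
  shows "alpha_limit K W \<phi> \<noteq> {}"
proof -
  have cells: "range \<phi> \<subseteq> cells K" using \<phi> by (simp add: solution_def)
  then obtain x where x: "\<And>m. \<exists>n>m. \<phi> (- int n) = x"
    using recurrent_value[of "\<lambda>n. \<phi> (- int n)"] by (auto simp: image_subset_iff)
  have "x \<in> Inv K W (upper_hull K W (\<phi> ` {..- int k}))" for k
  proof -
    obtain n where n: "n > k" "\<phi> (- int n) = x" using x by blast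
    obtain m where m: "m > n" "\<phi> (- int m) = x" using x by blast
    have "\<phi> ` {..- int k} \<subseteq> cells K" using cells by blast
    moreover have "\<phi> ` {- int m..- int n + 1} \<subseteq> \<phi> ` {..- int k}"
      using n(1) by (intro image_mono) auto
    ultimately show ?thesis
      by (intro recurrent_in_Inv[OF \<phi> _ m(2) n(2) compatible_upper_hull] order.trans[OF _ upper_hull_subset])
        (use m(1) in simp_all)
  qed
  then show ?thesis unfolding alpha_limit_def by blast
qed

lemma omega_limit_nonempty:
  assumes \<phi>: "full_solution K W \<phi>"
  shows "omega_limit K W \<phi> \<noteq> {}"
proof -
  have cells: "range \<phi> \<subseteq> cells K" using \<phi> by (simp add: solution_def)
  then obtain x where x: "\<And>m. \<exists>n>m. \<phi> (int n) = x"
    using recurrent_value[of "\<lambda>n. \<phi> (int n)"] by (auto simp: image_subset_iff)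
  have "x \<in> Inv K W (upper_hull K W (\<phi> ` {int k..}))" for k
  proof -
    obtain n where n: "n > k" "\<phi> (int n) = x" using x by blast
    obtain m where m: "m > n" "\<phi> (int m) = x" using x by blast
    have "\<phi> ` {int k..} \<subseteq> cells K" using cells by blast
    moreover have "\<phi> ` {int n..int m + 1} \<subseteq> \<phi> ` {int k..}"
      using n(1) by (intro image_mono) auto
    ultimately show ?thesis
      by (intro recurrent_in_Inv[OF \<phi> _ n(2) m(2) compatible_upper_hull] order.trans[OF _ upper_hull_subset])
        (use m(1) in simp_all)
  qed
  then show ?thesis unfolding omega_limit_def by blast
qed

end

lemma face_closed_subcomplex:
  assumes "face_closed K B" "B \<subseteq> E" "E \<subseteq> cells K"
  shows "face_closed (subcomplex K E) B"
proof -
  have "kappa K x y = 0" if "x \<in> B" "y \<in> E - B" for x y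
    using assms(1,3) that unfolding face_closed_def by blast
  then show ?thesis using assms(2) by (simp add: face_closed_def)
qed

context mv_field
begin

section \<open>Sets that contain no full solution\<close>

lemma face_closed_if_down:
  assumes "N \<subseteq> cells K" "\<And>x y. x \<in> N \<Longrightarrow> (y, x) \<in> face_order K \<Longrightarrow> y \<in> N"
  shows "face_closed K N"
  using assms face_kappa[OF lefschetz] unfolding face_closed_def by blast

text \<open>If every cell of \<open>T\<close> had a successor in \<open>T\<close>, iterating a
  choice of successors would revisit a cell by finiteness, and the loop would unwind to a full
  solution in \<open>T\<close>.\<close>

lemma terminal_cell:
  assumes T: "T \<subseteq> cells K" "T \<noteq> {}" and none: "\<And>\<phi>. full_solution K W \<phi> \<Longrightarrow> \<not> range \<phi> \<subseteq> T"
  obtains x where "x \<in> T" "Pi_mv K W x \<inter> T = {}"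
proof (rule ccontr)
  assume "\<not> thesis"
  then have "\<forall>x. \<exists>y. x \<in> T \<longrightarrow> y \<in> Pi_mv K W x \<inter> T" using that by blast
  from choice[OF this] obtain f where f: "\<And>x. x \<in> T \<Longrightarrow> f x \<in> Pi_mv K W x \<inter> T" by blast
  obtain x0 where x0: "x0 \<in> T" using T by blast
  define g where "g m = (f ^^ m) x0" for m
  have gT: "g m \<in> T" for m by (induction m) (use x0 f in \<open>auto simp: g_def\<close>)
  have step: "g (Suc m) \<in> Pi_mv K W (g m)" for m using f[OF gT[of m]] by (simp add: g_def)
  have "\<not> inj g"
  proof
    assume "inj g"
    then have "infinite (range g)" using finite_imageD infinite_UNIV_nat by blast
    moreover have "range g \<subseteq> cells K" using gT T(1) by blast
    ultimately show False using finite_subset finite_cells by blast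
  qed
  then obtain a b where ab: "a < b" "g a = g b" unfolding inj_def by (metis linorder_neqE_nat)
  define \<phi> where "\<phi> t = g (nat t)" for t :: int
  have "\<phi> (i + 1) \<in> Pi_mv K W (\<phi> i)" if "0 \<le> i" for i
    using step[of "nat i"] that by (simp add: \<phi>_def Suc_nat_eq_nat_zadd1 add.commute)
  moreover have "\<phi> i \<in> cells K" for i using gT[of "nat i"] T(1) by (auto simp: \<phi>_def)
  ultimately have sol: "solution K W {int a..int b} \<phi>" by (auto simp: solution_def)
  have "int a < int b" "\<phi> (int a) = \<phi> (int b)" using ab by (simp_all add: \<phi>_def)
  from solution_periodic[OF sol this] obtain \<psi>
    where "full_solution K W \<psi>" "range \<psi> \<subseteq> \<phi> ` {int a..int b}" .
  moreover have "\<phi> ` {int a..int b} \<subseteq> T" using gT by (auto simp: \<phi>_def)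
  ultimately show False using none by blast
qed

text \<open>A terminal cell is dominant, since otherwise it could step to its dominant cell, and its
  multivector \<open>V\<close> is regular, since otherwise it could stay. Faces of \<open>V\<close>
  in \<open>T - V\<close> would be successors, so \<open>V\<close> is closed in \<open>T\<close> and
  can be split off. Being a Lefschetz complex is kept as the inductive assumption because it passes
  to the complement \<open>T - V\<close>.\<close>

lemma poincare_no_solution:
  assumes ra: "rank_additive TYPE('r)"
    and "compatible K W T" "lefschetz_complex (subcomplex K T)"
    and "\<And>\<phi>. full_solution K W \<phi> \<Longrightarrow> \<not> range \<phi> \<subseteq> T"
  shows "poincare (subcomplex K T) = 0"
  using assms(2-4)
proof (induction "card T" arbitrary: T rule: less_induct)
  case (less T)
  have Tc: "T \<subseteq> cells K" using less.prems(1) by (simp add: compatible_def)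
  have finT: "finite T" using finite_subset[OF Tc finite_cells] .
  show ?case
  proof (cases "T = {}")
    case True then show ?thesis by (simp add: poincare_def)
  next
    case False
    obtain x where x: "x \<in> T" "Pi_mv K W x \<inter> T = {}"
      using terminal_cell[OF Tc False less.prems(3)] by blast
    have xc: "x \<in> cells K" using x(1) Tc by blast
    define V where "V = mv_of W x"
    have VT: "V \<subseteq> T" using less.prems(1) x(1) by (auto simp: V_def compatible_def)
    have xs: "x = star K W x"
    proof (rule ccontr)
      assume "x \<noteq> star K W x"
      moreover have "star K W x \<in> T" using compatible_star[OF less.prems(1) xc] x(1) by simp
      ultimately show False using Pi_not_star[OF xc] x(2) by blast
    qed
    have "\<not> critical K V"
    proof
      assume "critical K V"
      then have "x \<in> Pi_mv K W x" using xc xs by (simp add: Pi_mv_def V_def)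
      then show False using x by blast
    qed
    then have pV: "poincare (subcomplex K V) = 0"
      by (simp add: critical_def poincare_zero_homology)
    have closed: "face_closed (subcomplex K T) V"
      unfolding face_closed_def subcomplex_simps
    proof (intro conjI ballI VT)
      fix v y assume v: "v \<in> V" and y: "y \<in> T - V"
      show "kappa K v y = 0"
      proof (rule ccontr)
        assume "kappa K v y \<noteq> 0"
        moreover have "v \<in> cells K" "y \<in> cells K" using v y VT Tc by blast+
        ultimately have vy: "(y, v) \<in> face_order K" using face_kappa[OF lefschetz] by blast
        have "y \<notin> mv_of W v" using y mv_of_cong[OF xc, of v] v by (simp add: V_def)
        then have "y \<in> Pi_mv K W (star K W v)" using Pi_star_face[OF \<open>v \<in> cells K\<close> vy] by blast
        then have "y \<in> Pi_mv K W x" using star_cong[OF xc, of v] v xs by (simp add: V_def)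
        then show False using x(2) y by blast
      qed
    qed
    have "x \<in> V" using in_mv_of[OF xc] by (simp add: V_def)
    have "card (T - V) < card T"
      by (rule psubset_card_mono[OF finT]) (use \<open>x \<in> V\<close> x(1) in blast)
    moreover have "compatible K W (T - V)"
    proof (rule compatibleI_star)
      fix z assume z: "z \<in> cells K"
      have "star K W z \<in> V \<longleftrightarrow> z \<in> V"
      proof
        assume "star K W z \<in> V"
        then have "mv_of W z = V" using mv_of_cong[OF xc, of "star K W z"] mv_of_star[OF z] by (simp add: V_def)
        then show "z \<in> V" using in_mv_of[OF z] by blast
      next
        assume "z \<in> V"
        then have "mv_of W z = V" using mv_of_cong[OF xc, of z] by (simp add: V_def)
        then show "star K W z \<in> V" using star_in[OF z] by blast
      qed
      then show "star K W z \<in> T - V \<longleftrightarrow> z \<in> T - V" using compatible_star[OF less.prems(1) z] by blast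
    qed (use Tc in blast)
    moreover have "lefschetz_complex (subcomplex K (T - V))"
      using lefschetz_face_closed(2)[OF less.prems(2) closed] by simp
    moreover have "\<not> range \<phi> \<subseteq> T - V" if "full_solution K W \<phi>" for \<phi>
      using less.prems(3)[OF that] by blast
    ultimately have pC: "poincare (subcomplex K (T - V)) = 0" by (rule less.hyps)
    \<comment> \<open>The vanishing polynomial of the quotient \<open>T - V\<close> removes the
      correction term, so the polynomial of \<open>T\<close> is a sum of two zeros.\<close>
    obtain Q where "poincare (subcomplex K V) + poincare (subcomplex K (T - V))
        = poincare (subcomplex K T) + [:1, 1:] * Q"
      "poincare (subcomplex K (T - V)) = 0 \<Longrightarrow> Q = 0"
      using closed_pair_poincare[OF ra less.prems(2) closed] by auto
    then show ?thesis using pV pC by simp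
  qed
qed

section \<open>Restriction to a compatible proper subset\<close>

context
  fixes A assumes A: "compatible K W A" "proper K A"
begin

lemma sub_A: "A \<subseteq> cells K" using A(1) by (simp add: compatible_def)

lemma mv_of_restrict:
  assumes "x \<in> A"
  shows "mv_of (restrict_field W A) x = mv_of W x"
  unfolding mv_of_def[of "restrict_field W A"]
proof (rule the_equality)
  have x: "x \<in> cells K" using assms sub_A by blast
  show "mv_of W x \<in> restrict_field W A \<and> x \<in> mv_of W x"
    using mv_of_in[OF x] in_mv_of[OF x] A(1) assms by (simp add: restrict_field_def compatible_def)
  show "V = mv_of W x" if "V \<in> restrict_field W A \<and> x \<in> V" for V
    using that mv_of_eq[of V x] by (simp add: restrict_field_def)
qed

lemma is_maximal_restrict:
  assumes "V \<subseteq> A"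
  shows "is_maximal (subcomplex K A) V = is_maximal K V"
  using assms by (auto simp: is_maximal_def face_order_subcomplex[OF lefschetz A(2)] fun_eq_iff)

lemma mv_field_restrict: "mv_field (subcomplex K A) (restrict_field W A)"
proof
  note KA = lefschetz_proper[OF lefschetz A(2)]
  show "lefschetz_complex (subcomplex K A)" by (rule KA)
  have "partition_on A (restrict_field W A)"
  proof (rule partition_onI)
    show "\<Union> (restrict_field W A) = A"
    proof
      show "A \<subseteq> \<Union> (restrict_field W A)"
      proof
        fix x assume x: "x \<in> A"
        then have "x \<in> cells K" using sub_A by blast
        moreover have "mv_of W x \<subseteq> A" using x A(1) by (simp add: compatible_def)
        ultimately have "mv_of W x \<in> restrict_field W A" "x \<in> mv_of W x"
          using mv_of_in in_mv_of by (auto simp: restrict_field_def)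
        then show "x \<in> \<Union> (restrict_field W A)" by blast
      qed
    qed (auto simp: restrict_field_def)
    show "disjnt U V" if "U \<in> restrict_field W A" "V \<in> restrict_field W A" "U \<noteq> V" for U V
      using that field unfolding multivector_field_def partition_on_def disjoint_def disjnt_def restrict_field_def
      by blast
    show "{} \<notin> restrict_field W A"
      using field by (simp add: multivector_field_def partition_on_def restrict_field_def)
  qed
  moreover have "multivector (subcomplex K A) V" if V: "V \<in> restrict_field W A" for V
  proof -
    have VA: "V \<subseteq> A" and "multivector K V"
      using V field by (auto simp: restrict_field_def multivector_field_def)
    then have V: "proper K V" "\<exists>!m. is_maximal K V m" by (auto simp: multivector_def)
    have "proper (subcomplex K A) V"
      using V(1) VA unfolding proper_iff_convex[OF lefschetz] proper_iff_convex[OF KA]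
        face_order_subcomplex[OF lefschetz A(2)] subcomplex_simps by blast
    then show ?thesis using V(2) by (simp add: multivector_def is_maximal_restrict[OF VA])
  qed
  ultimately show "multivector_field (subcomplex K A) (restrict_field W A)"
    by (simp add: multivector_field_def)
qed

lemma star_restrict:
  assumes "x \<in> A"
  shows "star (subcomplex K A) (restrict_field W A) x = star K W x"
proof -
  have "mv_of W x \<subseteq> A" using assms A(1) by (simp add: compatible_def)
  then show ?thesis by (simp add: star_def mv_of_restrict[OF assms] is_maximal_restrict)
qed

lemma Pi_restrict:
  assumes x: "x \<in> A"
  shows "Pi_mv (subcomplex K A) (restrict_field W A) x = Pi_mv K W x \<inter> A"
proof -
  have "y \<in> cl (subcomplex K A) {x} \<longleftrightarrow> y \<in> cl K {x}" if "y \<in> A" for y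
    unfolding in_cl_singleton[OF lefschetz] in_cl_singleton[OF lefschetz_proper[OF lefschetz A(2)]]
    using x that by (simp add: face_order_subcomplex[OF lefschetz A(2)])
  then show ?thesis
    using sub_A by (auto simp: Pi_mv_def mv_of_restrict[OF x] star_restrict[OF x] critical_def)
qed

lemma solution_restrict:
  "full_solution (subcomplex K A) (restrict_field W A) \<phi> \<longleftrightarrow> full_solution K W \<phi> \<and> range \<phi> \<subseteq> A"
proof -
  have "\<phi> (i + 1) \<in> Pi_mv (subcomplex K A) (restrict_field W A) (\<phi> i) \<longleftrightarrow> \<phi> (i + 1) \<in> Pi_mv K W (\<phi> i)"
    if "range \<phi> \<subseteq> A" for i
  proof -
    have "\<phi> i \<in> A" "\<phi> (i + 1) \<in> A" using that by blast+
    then show ?thesis by (simp add: Pi_restrict)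
  qed
  then show ?thesis using sub_A by (auto simp: solution_def)
qed

lemma compatible_restrict:
  "compatible (subcomplex K A) (restrict_field W A) N \<longleftrightarrow> N \<subseteq> A \<and> compatible K W N"
proof -
  have "(\<forall>x\<in>N. mv_of (restrict_field W A) x \<subseteq> N) \<longleftrightarrow> (\<forall>x\<in>N. mv_of W x \<subseteq> N)" if "N \<subseteq> A"
    using that mv_of_restrict by (metis subsetD)
  then show ?thesis using sub_A by (auto simp: compatible_def)
qed

text \<open>Compatible subsets of \<open>N\<close> and solutions inside them are the same for both
  fields. Invariant parts in \<open>A\<close> can therefore be computed in the ambient
  complex.\<close>

lemma Inv_restrict:
  assumes "N \<subseteq> A"
  shows "Inv (subcomplex K A) (restrict_field W A) N = Inv K W N"
proof -
  have hull: "lower_hull (subcomplex K A) (restrict_field W A) N = lower_hull K W N"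
  proof -
    have "{B. B \<subseteq> N \<and> compatible (subcomplex K A) (restrict_field W A) B} = {B. B \<subseteq> N \<and> compatible K W B}"
      using assms by (auto simp: compatible_restrict)
    then show ?thesis by (simp add: lower_hull_def)
  qed
  have "lower_hull K W N \<subseteq> A" using lower_hull_subset assms by blast
  then have "Sol (subcomplex K A) (restrict_field W A) x (lower_hull K W N) = Sol K W x (lower_hull K W N)" for x
    unfolding Sol_def solution_restrict by blast
  moreover have "star (subcomplex K A) (restrict_field W A) x = star K W x" if "x \<in> N" for x
    using that assms by (intro star_restrict) blast
  ultimately show ?thesis unfolding Inv_def hull by auto
qed

lemma trapping_region_restrict:
  assumes "N \<subseteq> A" "compatible K W N" "\<And>x y. x \<in> N \<Longrightarrow> y \<in> Pi_mv K W x \<Longrightarrow> y \<in> A \<Longrightarrow> y \<in> N"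
  shows "trapping_region (subcomplex K A) (restrict_field W A) N"
proof -
  have "Pi_mv (subcomplex K A) (restrict_field W A) x \<subseteq> N" if "x \<in> N" for x
    using that assms Pi_restrict[of x] by blast
  then show ?thesis using assms by (auto simp: trapping_region_def compatible_restrict)
qed

lemma backward_trapping_region_restrict:
  assumes "N \<subseteq> A" "compatible K W N" "\<And>x y. x \<in> A \<Longrightarrow> y \<in> Pi_mv K W x \<Longrightarrow> y \<in> N \<Longrightarrow> x \<in> N"
  shows "backward_trapping_region (subcomplex K A) (restrict_field W A) N"
proof -
  have "x \<in> N" if "x \<in> A" "Pi_mv (subcomplex K A) (restrict_field W A) x \<inter> N \<noteq> {}" for x
    using that assms(3)[of x] Pi_restrict[of x] by blast
  then show ?thesis using assms(1,2)
    by (auto simp: backward_trapping_region_def Pi_preimage_def compatible_restrict)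
qed

end

end

section \<open>The attractor filtration of a Morse decomposition\<close>

text \<open>In the application \<open>K\<close> is the complex carried by \<open>S\<close>, so
  invariance of \<open>S\<close> appears as invariance of all cells. \<open>A 0\<close> is empty
  because \<open>{1..0}\<close> is.\<close>

locale morse_field = mv_field +
  fixes n :: nat and M :: "nat \<Rightarrow> 'a set" and A :: "nat \<Rightarrow> 'a set"
  assumes inv: "invariant K W (cells K)"
    and morse: "morse_decomposition K W {1..n} {(i, j). i \<in> {1..n} \<and> j \<in> {1..n} \<and> i \<le> j} M"
    and A_def: "A i = morse_set K W M {1..i}"
begin

lemma M_invariant: "r \<in> {1..n} \<Longrightarrow> invariant K W (M r)"
  using morse by (simp add: morse_decomposition_def isolated_invariant_def)

lemma M_compatible: "r \<in> {1..n} \<Longrightarrow> compatible K W (M r)"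
  by (simp add: M_invariant compatible_invariant)

lemma M_cells: "r \<in> {1..n} \<Longrightarrow> M r \<subseteq> cells K"
  using M_invariant by (simp add: invariant_def)

lemma M_disjoint: "r \<in> {1..n} \<Longrightarrow> s \<in> {1..n} \<Longrightarrow> r \<noteq> s \<Longrightarrow> M r \<inter> M s = {}"
  using morse by (simp add: morse_decomposition_def)

lemma limits:
  assumes "full_solution K W \<phi>"
  obtains r s where "r \<in> {1..n}" "s \<in> {1..n}" "s \<le> r" "alpha_limit K W \<phi> \<subseteq> M r" "omega_limit K W \<phi> \<subseteq> M s"
proof -
  have "\<exists>(r, r')\<in>{(i, j). i \<in> {1..n} \<and> j \<in> {1..n} \<and> i \<le> j}.
      alpha_limit K W \<phi> \<subseteq> M r' \<and> omega_limit K W \<phi> \<subseteq> M r"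
    using morse[unfolded morse_decomposition_def, THEN conjunct2, THEN conjunct2, THEN conjunct2,
        THEN conjunct2, THEN conjunct1, THEN spec, THEN mp, OF assms] .
  then obtain s r where "s \<in> {1..n}" "r \<in> {1..n}" "s \<le> r"
    "alpha_limit K W \<phi> \<subseteq> M r" "omega_limit K W \<phi> \<subseteq> M s" by (auto split: prod.splits)
  then show ?thesis by (intro that)
qed

lemma same_limits:
  assumes "full_solution K W \<phi>" "r \<in> {1..n}" "alpha_limit K W \<phi> \<subseteq> M r" "omega_limit K W \<phi> \<subseteq> M r"
  shows "range \<phi> \<subseteq> M r"
  using morse[unfolded morse_decomposition_def, THEN conjunct2, THEN conjunct2, THEN conjunct2,
      THEN conjunct2, THEN conjunct2] assms by simp

lemma alpha_unique:
  assumes "full_solution K W \<phi>" "r \<in> {1..n}" "s \<in> {1..n}" "alpha_limit K W \<phi> \<subseteq> M r" "alpha_limit K W \<phi> \<subseteq> M s"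
  shows "r = s"
  using M_disjoint[OF assms(2,3)] alpha_limit_nonempty[OF assms(1)] assms(4,5) by blast

lemma omega_unique:
  assumes "full_solution K W \<phi>" "r \<in> {1..n}" "s \<in> {1..n}" "omega_limit K W \<phi> \<subseteq> M r" "omega_limit K W \<phi> \<subseteq> M s"
  shows "r = s"
  using M_disjoint[OF assms(2,3)] omega_limit_nonempty[OF assms(1)] assms(4,5) by blast

text \<open>The \<open>\<alpha>\<close>-limit set alone decides membership: the order gives the
  \<open>\<omega>\<close>-limit set an index of at most \<open>r\<close>, hence again in
  \<open>{1..i}\<close>.\<close>

lemma A_I:
  assumes i: "i \<le> n" and x: "x \<in> cells K" and \<rho>: "full_solution K W \<rho>" "star K W x \<in> range \<rho>"
    and r: "r \<in> {1..i}" "alpha_limit K W \<rho> \<subseteq> M r"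
  shows "x \<in> A i"
proof -
  obtain r' s where rs: "r' \<in> {1..n}" "s \<in> {1..n}" "s \<le> r'" "alpha_limit K W \<rho> \<subseteq> M r'" "omega_limit K W \<rho> \<subseteq> M s"
    using limits[OF \<rho>(1)] .
  have "r \<in> {1..n}" using r(1) i by auto
  then have "r' = r" using alpha_unique[OF \<rho>(1) _ rs(1) r(2) rs(4)] by simp
  then have "s \<in> {1..i}" using rs r(1) by auto
  moreover have "\<rho> \<in> Sol K W (star K W x) (cells K)"
    using \<rho> by (simp add: Sol_def solution_def)
  ultimately show ?thesis
    unfolding A_def morse_set_def connections_def using x r rs(5) by blast
qed

lemma A_E:
  assumes "x \<in> A i"
  obtains \<rho> a r where "x \<in> cells K" "full_solution K W \<rho>" "\<rho> a = star K W x"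
    "r \<in> {1..i}" "alpha_limit K W \<rho> \<subseteq> M r"
proof -
  obtain r \<rho> where "x \<in> cells K" "r \<in> {1..i}" "\<rho> \<in> Sol K W (star K W x) (cells K)" "alpha_limit K W \<rho> \<subseteq> M r"
    using assms unfolding A_def morse_set_def connections_def by blast
  moreover from this obtain a where "\<rho> a = star K W x" by (auto simp: Sol_def)
  ultimately show ?thesis using that by (auto simp: Sol_def)
qed

lemma A_0: "A 0 = {}"
  by (simp add: A_def morse_set_def)

lemma A_cells: "A i \<subseteq> cells K"
  using A_E by blast

lemma A_mono: "i \<le> j \<Longrightarrow> A i \<subseteq> A j"
  unfolding A_def morse_set_def by (intro UN_mono) auto

lemma A_compatible:
  assumes "i \<le> n"
  shows "compatible K W (A i)"
proof (rule compatibleI_star[OF A_cells])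
  fix x assume x: "x \<in> cells K"
  show "star K W x \<in> A i \<longleftrightarrow> x \<in> A i"
  proof
    assume "star K W x \<in> A i"
    then obtain \<rho> a r where "full_solution K W \<rho>" "\<rho> a = star K W (star K W x)" "r \<in> {1..i}" "alpha_limit K W \<rho> \<subseteq> M r"
      using A_E by metis
    then show "x \<in> A i" using A_I[OF assms x, of \<rho> r] star_star[OF x] by (metis rangeI)
  next
    assume "x \<in> A i"
    then obtain \<rho> a r where "full_solution K W \<rho>" "\<rho> a = star K W x" "r \<in> {1..i}" "alpha_limit K W \<rho> \<subseteq> M r"
      using A_E by metis
    then show "star K W x \<in> A i"
      using A_I[OF assms star_cells[OF x], of \<rho> r] star_star[OF x] by (metis rangeI)
  qed
qed

text \<open>The definition of \<open>A i\<close> asks for a solution through the dominant cell. For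
  a value of \<open>\<rho>\<close> that cell is the value itself or the next one, so
  \<open>\<rho>\<close> serves all its values.\<close>

lemma alpha_range_A:
  assumes "i \<le> n" "full_solution K W \<rho>" "r \<in> {1..i}" "alpha_limit K W \<rho> \<subseteq> M r"
  shows "range \<rho> \<subseteq> A i"
proof
  fix x assume "x \<in> range \<rho>"
  then obtain t where t: "x = \<rho> t" by blast
  have x: "x \<in> cells K" using assms(2) t by (auto simp: solution_def)
  have "\<rho> (t + 1) \<in> Pi_mv K W x" using assms(2) t by (simp add: solution_def)
  then have "star K W x = \<rho> t \<or> star K W x = \<rho> (t + 1)"
    using Pi_not_star[OF x] t by (cases "x = star K W x") auto
  then have "star K W x \<in> range \<rho>" by auto
  then show "x \<in> A i" using A_I[OF assms(1) x assms(2)] assms(3,4) by blast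
qed

text \<open>The past of \<open>\<rho>\<close> up to the dominant cell of \<open>x\<close> is kept,
  the next step goes to the face \<open>y\<close>, and the future is a solution in \<open>N\<close>
  starting at \<open>y\<close>.\<close>

lemma divert:
  assumes \<rho>: "full_solution K W \<rho>" "\<rho> a = star K W x" and x: "x \<in> cells K"
    and y: "(y, x) \<in> face_order K" "y \<notin> mv_of W x" and N: "invariant K W N" "y \<in> N"
  obtains \<phi> where "full_solution K W \<phi>" "alpha_limit K W \<phi> = alpha_limit K W \<rho>"
    "omega_limit K W \<phi> \<subseteq> N" "star K W x \<in> range \<phi>" "y \<in> range \<phi>"
proof -
  obtain \<sigma> where \<sigma>: "solution K W {0..} \<sigma>" "\<sigma> ` {0..} \<subseteq> N" "\<sigma> 0 = y"
    using invariant_forward_solution[OF N] .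
  define \<phi> where "\<phi> t = (if t \<le> a then \<rho> t else \<sigma> (t - a - 1))" for t
  have "full_solution K W \<phi>"
    unfolding \<phi>_def by (rule solution_glue[OF \<rho>(1) \<sigma>(1)]) (simp add: \<sigma> \<rho> Pi_star_face[OF x y])
  moreover have "alpha_limit K W \<phi> = alpha_limit K W \<rho>"
    by (rule alpha_limit_cong[of a]) (simp add: \<phi>_def)
  moreover have "\<phi> ` {a + 1..} \<subseteq> N" using \<sigma>(2) by (auto simp: \<phi>_def image_subset_iff)
  then have "omega_limit K W \<phi> \<subseteq> N" by (rule omega_limit_subset[OF compatible_invariant[OF N(1)]])
  moreover have "star K W x = \<phi> a" "y = \<phi> (a + 1)" by (simp_all add: \<phi>_def \<rho> \<sigma>)
  ultimately show ?thesis using that by blast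
qed

lemma A_down:
  assumes i: "i \<le> n" and x: "x \<in> A i" and y: "(y, x) \<in> face_order K"
  shows "y \<in> A i"
proof -
  obtain \<rho> a r where \<rho>: "x \<in> cells K" "full_solution K W \<rho>" "\<rho> a = star K W x" "r \<in> {1..i}" "alpha_limit K W \<rho> \<subseteq> M r"
    using A_E[OF x] .
  show ?thesis
  proof (cases "y \<in> mv_of W x")
    case True
    then show ?thesis using A_compatible[OF i] x by (auto simp: compatible_def)
  next
    case False
    have "y \<in> cells K" using face_cells[OF lefschetz y] by simp
    \<comment> \<open>The target is the whole complex: its invariance guarantees that
      \<open>y\<close> has a future.\<close>
    then obtain \<phi> where "full_solution K W \<phi>" "alpha_limit K W \<phi> = alpha_limit K W \<rho>" "y \<in> range \<phi>"
      using divert[OF \<rho>(2,3,1) y False inv] by metis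
    then show ?thesis using alpha_range_A[OF i _ \<rho>(4), of \<phi>] \<rho>(5) by auto
  qed
qed

lemma A_Pi:
  assumes "i \<le> n" "x \<in> A i" "y \<in> Pi_mv K W x"
  shows "y \<in> A i"
proof -
  have "x \<in> cells K" using assms(2) A_cells by blast
  then show ?thesis
    using Pi_star_cases[OF _ assms(3)] A_down[OF assms(1,2)] compatible_star[OF A_compatible[OF assms(1)]] assms(2)
    by blast
qed

section \<open>Position of the Morse sets in the filtration\<close>

lemma M_solution:
  assumes "i \<in> {1..n}" "x \<in> M i"
  obtains \<rho> a where "full_solution K W \<rho>" "\<rho> a = star K W x" "range \<rho> \<subseteq> M i"
    "alpha_limit K W \<rho> \<subseteq> M i" "omega_limit K W \<rho> \<subseteq> M i"
proof -
  obtain \<rho> a where \<rho>: "full_solution K W \<rho>" "range \<rho> \<subseteq> M i" "\<rho> a = star K W x"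
    using invariant_solution[OF M_invariant[OF assms(1)] assms(2)] .
  have half: "\<rho> ` {..0} \<subseteq> M i" "\<rho> ` {0..} \<subseteq> M i" using \<rho>(2) by auto
  note M_compatible[OF assms(1)]
  from that[OF \<rho>(1,3,2) alpha_limit_subset[OF this half(1)] omega_limit_subset[OF this half(2)]]
  show ?thesis .
qed

lemma M_subset_A:
  assumes "i \<in> {1..n}"
  shows "M i \<subseteq> A i"
proof
  fix x assume x: "x \<in> M i"
  obtain \<rho> a where \<rho>: "full_solution K W \<rho>" "\<rho> a = star K W x" "alpha_limit K W \<rho> \<subseteq> M i"
    using M_solution[OF assms x] by metis
  have "star K W x \<in> range \<rho>" by (simp flip: \<rho>(2))
  then show "x \<in> A i" using A_I[of i x \<rho> i] \<rho> assms M_cells[OF assms] x by auto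
qed

text \<open>At the dominant cell of a common cell, a past coming from some \<open>M s\<close> with
  \<open>s \<le> j\<close> can be joined to a future inside \<open>M r\<close>. Such a solution
  would climb from \<open>s\<close> to the larger index \<open>r\<close>, against the order.\<close>

lemma M_disjoint_A:
  assumes r: "r \<in> {1..n}" and j: "j < r"
  shows "M r \<inter> A j = {}"
proof (rule ccontr)
  assume "M r \<inter> A j \<noteq> {}"
  then obtain x where x: "x \<in> M r" "x \<in> A j" by blast
  obtain \<rho> a s where \<rho>: "x \<in> cells K" "full_solution K W \<rho>" "\<rho> a = star K W x" "s \<in> {1..j}" "alpha_limit K W \<rho> \<subseteq> M s"
    using A_E[OF x(2)] .
  obtain \<tau> b where \<tau>: "full_solution K W \<tau>" "\<tau> b = star K W x" "range \<tau> \<subseteq> M r"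
    using M_solution[OF r x(1)] by metis
  define \<phi> where "\<phi> t = (if t \<le> a then \<rho> t else \<tau> (b + 1 + (t - a - 1)))" for t
  have step: "\<tau> (t + 1) \<in> Pi_mv K W (\<tau> t)" for t using \<tau>(1) by (simp add: solution_def)
  have "\<tau> (b + 1 + (t + 1)) \<in> Pi_mv K W (\<tau> (b + 1 + t))" for t using step[of "b + 1 + t"] by (simp add: add.assoc)
  then have "solution K W {0..} (\<lambda>t. \<tau> (b + 1 + t))" using \<tau>(1) by (auto simp: solution_def)
  then have full: "full_solution K W \<phi>"
    unfolding \<phi>_def by (rule solution_glue[OF \<rho>(2)]) (use step[of b] \<tau>(2) \<rho>(3) in simp)
  have "alpha_limit K W \<phi> = alpha_limit K W \<rho>" by (rule alpha_limit_cong[of a]) (simp add: \<phi>_def)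
  then have \<alpha>: "alpha_limit K W \<phi> \<subseteq> M s" using \<rho>(5) by simp
  have "\<phi> ` {a + 1..} \<subseteq> M r" using \<tau>(3) by (auto simp: \<phi>_def)
  then have \<omega>: "omega_limit K W \<phi> \<subseteq> M r" by (rule omega_limit_subset[OF M_compatible[OF r]])
  obtain r' s' where rs: "r' \<in> {1..n}" "s' \<in> {1..n}" "s' \<le> r'" "alpha_limit K W \<phi> \<subseteq> M r'" "omega_limit K W \<phi> \<subseteq> M s'"
    using limits[OF full] .
  have "s \<in> {1..n}" using \<rho>(4) r j by auto
  then have "r' = s" using alpha_unique[OF full rs(1) _ rs(4) \<alpha>] by simp
  moreover have "s' = r" using omega_unique[OF full rs(2) r rs(5) \<omega>] .
  ultimately show False using rs(3) \<rho>(4) j by auto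
qed

lemma alpha_index:
  assumes i: "i \<le> n" and \<phi>: "full_solution K W \<phi>" "range \<phi> \<subseteq> A i"
  obtains r where "r \<in> {1..i}" "alpha_limit K W \<phi> \<subseteq> M r"
proof -
  obtain r where r: "r \<in> {1..n}" "alpha_limit K W \<phi> \<subseteq> M r" using limits[OF \<phi>(1)] by metis
  have "alpha_limit K W \<phi> \<subseteq> A i"
    by (rule alpha_limit_subset[OF A_compatible[OF i], of \<phi> 0]) (use \<phi>(2) in blast)
  then have "M r \<inter> A i \<noteq> {}" using alpha_limit_nonempty[OF \<phi>(1)] r(2) by blast
  then have "r \<le> i" using M_disjoint_A[OF r(1), of i] by (meson not_less)
  then show ?thesis using that r by auto
qed

lemma omega_index:
  assumes i: "i \<le> n" and \<phi>: "full_solution K W \<phi>" "range \<phi> \<subseteq> A i"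
  obtains r where "r \<in> {1..i}" "omega_limit K W \<phi> \<subseteq> M r"
proof -
  obtain r where r: "r \<in> {1..n}" "omega_limit K W \<phi> \<subseteq> M r" using limits[OF \<phi>(1)] by metis
  have "omega_limit K W \<phi> \<subseteq> A i"
    by (rule omega_limit_subset[OF A_compatible[OF i], of \<phi> 0]) (use \<phi>(2) in blast)
  then have "M r \<inter> A i \<noteq> {}" using omega_limit_nonempty[OF \<phi>(1)] r(2) by blast
  then have "r \<le> i" using M_disjoint_A[OF r(1), of i] by (meson not_less)
  then show ?thesis using that r by auto
qed

text \<open>Both limit sets avoid \<open>A (i - 1)\<close>, which contains every earlier Morse set,
  so both lie in \<open>M i\<close>; the third condition of a Morse decomposition does the
  rest.\<close>

lemma solution_outside_previous:
  assumes i: "i \<in> {1..n}" and \<phi>: "full_solution K W \<phi>" "range \<phi> \<subseteq> A i - A (i - 1)"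
  shows "range \<phi> \<subseteq> M i"
proof -
  have in': "i \<le> n" "i - 1 \<le> n" using i by auto
  have range: "range \<phi> \<subseteq> A i" using \<phi>(2) by blast
  have comp: "compatible K W (A i - A (i - 1))" using in' by (intro compatible_diff A_compatible)
  have M_prev: "M r \<subseteq> A (i - 1)" if "r \<in> {1..i}" "r \<noteq> i" for r
  proof -
    have "r \<in> {1..n}" "r \<le> i - 1" using that i by auto
    then show ?thesis using M_subset_A[of r] A_mono[of r "i - 1"] by blast
  qed
  obtain r where r: "r \<in> {1..i}" "alpha_limit K W \<phi> \<subseteq> M r" using alpha_index[OF in'(1) \<phi>(1) range] .
  have "alpha_limit K W \<phi> \<subseteq> A i - A (i - 1)"
    by (rule alpha_limit_subset[OF comp, of \<phi> 0]) (use \<phi>(2) in blast)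
  then have "r = i" using M_prev[of r] r alpha_limit_nonempty[OF \<phi>(1)] by blast
  obtain s where s: "s \<in> {1..i}" "omega_limit K W \<phi> \<subseteq> M s" using omega_index[OF in'(1) \<phi>(1) range] .
  have "omega_limit K W \<phi> \<subseteq> A i - A (i - 1)"
    by (rule omega_limit_subset[OF comp, of \<phi> 0]) (use \<phi>(2) in blast)
  then have "s = i" using M_prev[of s] s omega_limit_nonempty[OF \<phi>(1)] by blast
  show ?thesis using same_limits[OF \<phi>(1) i] r s \<open>r = i\<close> \<open>s = i\<close> by simp
qed

lemma Inv_A:
  assumes "i \<le> n"
  shows "Inv K W (A i) = A i"
proof
  show "A i \<subseteq> Inv K W (A i)"
  proof
    fix x assume x: "x \<in> A i"
    obtain \<rho> a r where \<rho>: "full_solution K W \<rho>" "\<rho> a = star K W x" "r \<in> {1..i}" "alpha_limit K W \<rho> \<subseteq> M r"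
      using A_E[OF x] by metis
    then have "range \<rho> \<subseteq> A i" using alpha_range_A[OF assms] by blast
    then show "x \<in> Inv K W (A i)"
      unfolding in_Inv[OF A_compatible[OF assms]] using x \<rho>(1,2) by (metis rangeI)
  qed
qed (rule Inv_subset)

lemma Inv_A_diff_A:
  assumes i: "i \<in> {1..n}"
  shows "Inv K W (A i - A (i - 1)) = M i"
proof -
  have "i \<le> n" "i - 1 \<le> n" "i - 1 < i" using i by auto
  then have comp: "compatible K W (A i - A (i - 1))" by (intro compatible_diff A_compatible)
  have sub: "M i \<subseteq> A i - A (i - 1)" using M_subset_A[OF i] M_disjoint_A[OF i \<open>i - 1 < i\<close>] by blast
  show ?thesis
  proof
    show "M i \<subseteq> Inv K W (A i - A (i - 1))"
      using Inv_mono[OF sub] M_invariant[OF i] by (simp add: invariant_def)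
    show "Inv K W (A i - A (i - 1)) \<subseteq> M i"
    proof
      fix x assume "x \<in> Inv K W (A i - A (i - 1))"
      then obtain \<phi> where x: "x \<in> A i" and \<phi>: "full_solution K W \<phi>" "range \<phi> \<subseteq> A i - A (i - 1)" "star K W x \<in> range \<phi>"
        unfolding in_Inv[OF comp] by blast
      have "star K W x \<in> M i" using solution_outside_previous[OF i \<phi>(1,2)] \<phi>(3) by blast
      then show "x \<in> M i" using compatible_star[OF M_compatible[OF i]] x A_cells by blast
    qed
  qed
qed

text \<open>A solution avoiding \<open>M i\<close> has its \<open>\<alpha>\<close>-limit set in a
  Morse set of index below \<open>i\<close>, which by \<open>A_I\<close> suffices for membership in
  \<open>A (i - 1)\<close>.\<close>

lemma Inv_A_diff_M:
  assumes i: "i \<in> {1..n}"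
  shows "Inv K W (A i - M i) = A (i - 1)"
proof -
  have in': "i \<le> n" "i - 1 \<le> n" "i - 1 < i" using i by auto
  then have comp: "compatible K W (A i - M i)" using i by (intro compatible_diff A_compatible M_compatible)
  have sub: "A (i - 1) \<subseteq> A i - M i" using A_mono[of "i - 1" i] M_disjoint_A[OF i in'(3)] by auto
  show ?thesis
  proof
    show "A (i - 1) \<subseteq> Inv K W (A i - M i)"
      using Inv_mono[OF sub] Inv_A[OF in'(2)] by simp
    show "Inv K W (A i - M i) \<subseteq> A (i - 1)"
    proof
      fix x assume "x \<in> Inv K W (A i - M i)"
      then obtain \<phi> where x: "x \<in> A i" and \<phi>: "full_solution K W \<phi>" "range \<phi> \<subseteq> A i - M i" "star K W x \<in> range \<phi>"
        unfolding in_Inv[OF comp] by blast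
      have "range \<phi> \<subseteq> A i" using \<phi>(2) by blast
      then obtain r where r: "r \<in> {1..i}" "alpha_limit K W \<phi> \<subseteq> M r" using alpha_index[OF in'(1) \<phi>(1)] by blast
      have "alpha_limit K W \<phi> \<subseteq> A i - M i"
        by (rule alpha_limit_subset[OF comp, of \<phi> 0]) (use \<phi>(2) in blast)
      then have "r \<noteq> i" using r alpha_limit_nonempty[OF \<phi>(1)] by blast
      then have "r \<in> {1..i - 1}" using r(1) by auto
      then show "x \<in> A (i - 1)" using A_I[OF in'(2) _ \<phi>(1,3)] r(2) x A_cells by blast
    qed
  qed
qed

lemma A_n: "A n = cells K"
proof
  show "cells K \<subseteq> A n"
  proof
    fix x assume x: "x \<in> cells K"
    obtain \<phi> a where \<phi>: "full_solution K W \<phi>" "\<phi> a = star K W x"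
      using invariant_solution[OF inv x] by metis
    obtain r where "r \<in> {1..n}" "alpha_limit K W \<phi> \<subseteq> M r" using limits[OF \<phi>(1)] by metis
    then show "x \<in> A n" using A_I[OF order.refl x \<phi>(1)] \<phi>(2) by (metis rangeI)
  qed
qed (rule A_cells)

lemma A_proper:
  assumes "i \<le> n"
  shows "proper K (A i)"
  unfolding proper_iff_convex[OF lefschetz] using A_cells A_down[OF assms] by blast

text \<open>\<open>A (i - 1)\<close> is forward closed in all of \<open>K\<close>, so it is a
  trapping region in \<open>A i\<close> and its complement there a backward trapping region; their
  invariant parts are \<open>A (i - 1)\<close> and \<open>M i\<close>.\<close>

lemma attractor_repeller:
  assumes i: "i \<in> {1..n}"
  shows "attractor_repeller_pair (subcomplex K (A i)) (restrict_field W (A i)) (A (i - 1)) (M i)"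
proof -
  have in': "i \<le> n" "i - 1 \<le> n" "i - 1 \<le> i" using i by auto
  note Ai = A_compatible[OF in'(1)] A_proper[OF in'(1)]
  have sub: "A (i - 1) \<subseteq> A i" using A_mono[OF in'(3)] .
  have comp: "compatible K W (A i - A (i - 1))" using in' by (intro compatible_diff A_compatible)
  have "trapping_region (subcomplex K (A i)) (restrict_field W (A i)) (A (i - 1))"
    by (rule trapping_region_restrict[OF Ai sub A_compatible[OF in'(2)]]) (rule A_Pi[OF in'(2)])
  moreover have "backward_trapping_region (subcomplex K (A i)) (restrict_field W (A i)) (A i - A (i - 1))"
    by (rule backward_trapping_region_restrict[OF Ai _ comp]) (use A_Pi[OF in'(2)] in blast)+
  ultimately show ?thesis
    unfolding attractor_repeller_pair_def attractor_def repeller_def subcomplex_simps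
    using Inv_restrict[OF Ai sub] Inv_restrict[OF Ai, of "A i - A (i - 1)"] Inv_restrict[OF Ai, of "A i - M i"]
      Inv_A[OF in'(2)] Inv_A_diff_A[OF i] Inv_A_diff_M[OF i] by (metis Diff_subset)
qed

text \<open>A cell of \<open>A i\<close> outside \<open>M i\<close> with a face in \<open>M i\<close> would lie on a solution
  whose limit sets are both in \<open>M i\<close>.\<close>

lemma A_diff_M_down:
  assumes i: "i \<in> {1..n}" and x: "x \<in> A i - M i" and y: "(y, x) \<in> face_order K"
  shows "y \<in> A i - M i"
proof -
  have in': "i \<le> n" using i by auto
  have "y \<notin> M i"
  proof
    assume yM: "y \<in> M i"
    obtain \<rho> a r where \<rho>: "x \<in> cells K" "full_solution K W \<rho>" "\<rho> a = star K W x" "r \<in> {1..i}" "alpha_limit K W \<rho> \<subseteq> M r"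
      using A_E x by (metis DiffD1)
    have "y \<notin> mv_of W x" using compatible_mv_of[OF M_compatible[OF i] \<rho>(1)] yM x by blast
    then obtain \<phi> where \<phi>: "full_solution K W \<phi>" "alpha_limit K W \<phi> \<subseteq> M r" "omega_limit K W \<phi> \<subseteq> M i"
      "star K W x \<in> range \<phi>"
      using divert[OF \<rho>(2,3,1) y _ M_invariant[OF i] yM] \<rho>(5) by metis
    obtain r' s where rs: "r' \<in> {1..n}" "s \<in> {1..n}" "s \<le> r'" "alpha_limit K W \<phi> \<subseteq> M r'" "omega_limit K W \<phi> \<subseteq> M s"
      using limits[OF \<phi>(1)] .
    have "r \<in> {1..n}" using \<rho>(4) in' by auto
    then have "r' = r" using alpha_unique[OF \<phi>(1) rs(1) _ rs(4) \<phi>(2)] by simp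
    moreover have "s = i" using omega_unique[OF \<phi>(1) rs(2) i rs(5) \<phi>(3)] .
    ultimately have "r = i" using rs(3) \<rho>(4) by auto
    then have "star K W x \<in> M i" using same_limits[OF \<phi>(1) i] \<phi> by blast
    then show False using compatible_star[OF M_compatible[OF i] \<rho>(1)] x by blast
  qed
  then show ?thesis using A_down[OF in' _ y] x by blast
qed

text \<open>A nonzero coefficient would give a solution that comes out of \<open>M i\<close> and
  passes through \<open>y\<close>. Its future cannot return to \<open>M i\<close>, as it would then
  lie wholly in \<open>M i\<close>; so it ends in a lower Morse set, and \<open>x\<close> lies on a
  connection.\<close>

lemma no_connection:
  assumes i: "i \<in> {1..n}" and none: "connections K W (M i) (A (i - 1)) = {}"
    and x: "x \<in> M i" and y: "y \<in> A i - M i"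
  shows "kappa K x y = 0"
proof (rule ccontr)
  assume "kappa K x y \<noteq> 0"
  have in': "i \<le> n" "i - 1 \<le> n" using i by auto
  have cells: "x \<in> cells K" "y \<in> cells K" using x y M_cells[OF i] A_cells by blast+
  have yx: "(y, x) \<in> face_order K" using face_kappa[OF lefschetz cells \<open>kappa K x y \<noteq> 0\<close>] .
  have "y \<notin> mv_of W x" using compatible_mv_of[OF M_compatible[OF i] cells(1)] x y by blast
  obtain \<rho> a where \<rho>: "full_solution K W \<rho>" "\<rho> a = star K W x" "alpha_limit K W \<rho> \<subseteq> M i"
    using M_solution[OF i x] by metis
  obtain \<phi> where \<phi>: "full_solution K W \<phi>" "alpha_limit K W \<phi> \<subseteq> M i" "star K W x \<in> range \<phi>" "y \<in> range \<phi>"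
    using divert[OF \<rho>(1,2) cells(1) yx \<open>y \<notin> mv_of W x\<close> inv cells(2)] \<rho>(3) by metis
  obtain r s where rs: "r \<in> {1..n}" "s \<in> {1..n}" "s \<le> r" "alpha_limit K W \<phi> \<subseteq> M r" "omega_limit K W \<phi> \<subseteq> M s"
    using limits[OF \<phi>(1)] .
  have "r = i" using alpha_unique[OF \<phi>(1) rs(1) i rs(4) \<phi>(2)] .
  have "s \<noteq> i" using same_limits[OF \<phi>(1) i \<phi>(2)] rs(5) \<phi>(4) y by blast
  then have "s \<le> i - 1" using rs(3) \<open>r = i\<close> by simp
  then have "omega_limit K W \<phi> \<subseteq> A (i - 1)" using M_subset_A[OF rs(2)] A_mono rs(5) by blast
  moreover have "\<phi> \<in> Sol K W (star K W x) (cells K)" using \<phi> by (simp add: Sol_def solution_def)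
  ultimately have "x \<in> connections K W (M i) (A (i - 1))"
    using \<phi>(2) cells(1) by (auto simp: connections_def)
  then show False using none by blast
qed

lemma morse_step:
  assumes ra: "rank_additive TYPE('b)" and i: "i \<in> {1..n}"
  obtains Q where "\<forall>k. 0 \<le> coeff Q k"
    "poincare (subcomplex K (A (i - 1))) + poincare (subcomplex K (M i)) = poincare (subcomplex K (A i)) + [:1, 1:] * Q"
    "Q \<noteq> 0 \<Longrightarrow> connections K W (M i) (A (i - 1)) \<noteq> {}"
proof -
  have in': "i \<le> n" "i - 1 \<le> n" "i - 1 < i" using i by auto
  define U where "U = A i - M i"
  have UA: "U \<subseteq> A i" "A (i - 1) \<subseteq> U" "A i - U = M i"
    using A_mono[of "i - 1" i] M_disjoint_A[OF i in'(3)] M_subset_A[OF i] by (auto simp: U_def)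
  have cells: "A i \<subseteq> cells K" "U \<subseteq> cells K" using A_cells UA by blast+
  have closed: "face_closed K (A i)" "face_closed K U" "face_closed K (A (i - 1))"
    using cells UA A_down[OF in'(1)] A_down[OF in'(2)] A_diff_M_down[OF i]
    by (auto intro!: face_closed_if_down simp flip: U_def)
  note lef = lefschetz_face_closed(1)[OF lefschetz closed(1)] lefschetz_face_closed(1)[OF lefschetz closed(2)]
  have rel: "face_closed (subcomplex K (A i)) U" "face_closed (subcomplex K U) (A (i - 1))"
    by (rule face_closed_subcomplex[OF closed(2) UA(1) cells(1)],
        rule face_closed_subcomplex[OF closed(3) UA(2) cells(2)])
  have "poincare (subcomplex K (U - A (i - 1))) = 0"
  proof (rule poincare_no_solution[OF ra])
    show "compatible K W (U - A (i - 1))"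
      unfolding U_def using i in' by (intro compatible_diff A_compatible M_compatible)
    show "lefschetz_complex (subcomplex K (U - A (i - 1)))"
      using lefschetz_face_closed(2)[OF lef(2) rel(2)] by simp
    show "\<not> range \<phi> \<subseteq> U - A (i - 1)" if \<phi>: "full_solution K W \<phi>" for \<phi>
    proof
      assume r: "range \<phi> \<subseteq> U - A (i - 1)"
      then have "range \<phi> \<subseteq> A i - A (i - 1)" using UA by blast
      then have "range \<phi> \<subseteq> M i" by (rule solution_outside_previous[OF i \<phi>])
      then show False using r unfolding U_def by blast
    qed
  qed
  \<comment> \<open>For the pair \<open>(U, A (i - 1))\<close> the quotient has polynomial 0, which
    forces its correction term to vanish too.\<close>
  then have U: "poincare (subcomplex K U) = poincare (subcomplex K (A (i - 1)))"
    using closed_pair_poincare[OF ra lef(2) rel(2)] by (metis add.right_neutral mult_zero_right subcomplex_simps(1,4))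
  obtain Q where Q: "\<forall>k. 0 \<le> coeff Q k"
    "poincare (subcomplex K U) + poincare (subcomplex K (M i)) = poincare (subcomplex K (A i)) + [:1, 1:] * Q"
    "(\<forall>x\<in>M i. \<forall>y\<in>U. kappa K x y = 0) \<longrightarrow> Q = 0"
    by (rule closed_pair_poincare[OF ra lef(1) rel(1), unfolded subcomplex_simps UA(3)])
  show ?thesis
  proof (rule that[OF Q(1)])
    show "poincare (subcomplex K (A (i - 1))) + poincare (subcomplex K (M i)) = poincare (subcomplex K (A i)) + [:1, 1:] * Q"
      using Q(2) U by simp
    show "connections K W (M i) (A (i - 1)) \<noteq> {}" if "Q \<noteq> 0"
      using that Q(3) no_connection[OF i] unfolding U_def by blast
  qed
qed

text \<open>The equations of \<open>morse_step\<close> telescope from the empty set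
  \<open>A 0\<close> to \<open>A n\<close>, which is the whole complex. For \<open>i = 1\<close> the
  last clause forces \<open>q 1 = 0\<close>, because no nonempty limit set fits into
  \<open>A 0\<close>.\<close>

lemma morse_equation:
  assumes ra: "rank_additive TYPE('b)"
  shows "\<exists>q :: nat \<Rightarrow> int poly. (\<forall>i\<in>{1..n}. \<forall>k. coeff (q i) k \<ge> 0)
    \<and> (\<Sum>i=1..n. poincare (subcomplex K (M i))) = poincare K + [:1, 1:] * (\<Sum>i=1..n. q i)
    \<and> (\<forall>i\<in>{1..n}. q i \<noteq> 0 \<longrightarrow> connections K W (M i) (A (i - 1)) \<noteq> {})"
proof -
  have "\<forall>i. \<exists>Q. i \<in> {1..n} \<longrightarrow> (\<forall>k. 0 \<le> coeff Q k)
    \<and> poincare (subcomplex K (A (i - 1))) + poincare (subcomplex K (M i)) = poincare (subcomplex K (A i)) + [:1, 1:] * Q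
    \<and> (Q \<noteq> 0 \<longrightarrow> connections K W (M i) (A (i - 1)) \<noteq> {})"
    using morse_step[OF ra] by metis
  from choice[OF this] obtain q where q: "\<And>i. i \<in> {1..n} \<Longrightarrow> (\<forall>k. 0 \<le> coeff (q i) k)
    \<and> poincare (subcomplex K (A (i - 1))) + poincare (subcomplex K (M i)) = poincare (subcomplex K (A i)) + [:1, 1:] * q i
    \<and> (q i \<noteq> 0 \<longrightarrow> connections K W (M i) (A (i - 1)) \<noteq> {})" by blast
  have "(\<Sum>i=1..m. poincare (subcomplex K (M i))) = poincare (subcomplex K (A m)) + [:1, 1:] * (\<Sum>i=1..m. q i)"
    if "m \<le> n" for m
    using that
  proof (induction m)
    case 0
    then show ?case by (simp add: A_0 poincare_def)
  next
    case (Suc m)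
    have "poincare (subcomplex K (A m)) + poincare (subcomplex K (M (Suc m))) =
        poincare (subcomplex K (A (Suc m))) + [:1, 1:] * q (Suc m)"
      using q[of "Suc m"] Suc.prems by simp
    then show ?case using Suc by (simp add: distrib_left)
  qed
  from this[of n] have "(\<Sum>i=1..n. poincare (subcomplex K (M i))) = poincare K + [:1, 1:] * (\<Sum>i=1..n. q i)"
    by (simp add: A_n)
  then show ?thesis using q by (intro exI[of _ q]) blast
qed

end

theorem theorem9p11:
  fixes X :: "('x, 'r::ring_1) lefschetz" and \<V> :: "'x set set"
    and S :: "'x set" and n :: nat and M A :: "nat \<Rightarrow> 'x set"
    and K :: "('x, 'r) lefschetz" and \<W> :: "'x set set"
  assumes "lefschetz_complex X"
    and "multivector_field X \<V>"
    and "invariant X \<V> (cells X)"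
    and "isolated_invariant X \<V> S"
    and "proper X S"
    and "K = subcomplex X S" and "\<W> = restrict_field \<V> S"
    and "morse_decomposition K \<W> {1..n} {(i, j). i \<in> {1..n} \<and> j \<in> {1..n} \<and> i \<le> j} M"
    and "A = (\<lambda>i. if i = 0 then {} else morse_set K \<W> M {1..i})"
  shows "(\<forall>i\<in>{1..n}.
            attractor_repeller_pair (subcomplex K (A i)) (restrict_field \<W> (A i)) (A (i - 1)) (M i))
     \<and> (rank_additive TYPE('r) \<longrightarrow>
          (\<exists>q :: nat \<Rightarrow> int poly.
             (\<forall>i\<in>{1..n}. \<forall>k. coeff (q i) k \<ge> 0)
           \<and> (\<Sum>i=1..n. poincare (subcomplex K (M i))) = poincare K + [:1, 1:] * (\<Sum>i=1..n. q i)
           \<and> (\<forall>i\<in>{2..n}. q i \<noteq> 0 \<longrightarrow> connections K \<W> (M i) (A (i - 1)) \<noteq> {})))"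
proof -
  interpret X: mv_field X \<V> using assms(1,2) by unfold_locales
  have S: "compatible X \<V> S" "proper X S" "invariant X \<V> S"
    using assms(4,5) X.compatible_invariant by (auto simp: isolated_invariant_def)
  interpret K: mv_field K \<W>
    unfolding assms(6,7) by (rule X.mv_field_restrict[OF S(1,2)])
  \<comment> \<open>Here \<open>cells K\<close> is \<open>S\<close>, and its invariant part is the
    same for the restricted field as for \<open>\<V>\<close>.\<close>
  have inv: "invariant K \<W> (cells K)"
    using X.Inv_restrict[OF S(1,2) order.refl] S(3) by (simp add: invariant_def assms(6,7))
  have A: "A i = morse_set K \<W> M {1..i}" for i
    by (simp add: assms(9) morse_set_def)
  interpret morse_field K \<W> n M A
    using inv assms(8) A by unfold_locales
  have "{2..n} \<subseteq> {1..n}" by auto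
  then show ?thesis using attractor_repeller morse_equation by (meson subsetD)
qed

end
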